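(* Let $X$ be a minimal shift space. The following are equivalent: (1) $X$ is eventually dendric; (2) there exists a nonempty $w\in\mathcal{L}(X)$ such that the derived shift $\mathcal{D}_w(X)$ is dendric; (3) there exists $N$ such that for every $w\in\mathcal{L}(X)$ with $|w|\ge N$, the derived shift $\mathcal{D}_w(X)$ is dendric.
   Context: Shift spaces over a finite alphabet $\mathcal{A}$: nonempty closed shift-invariant subsets of $\mathcal{A}^{\mathbb{Z}}$ with language $\mathcal{L}(X)$; minimal: no nonempty proper closed shift-invariant subset. For $w\in\mathcal{L}(X)$: $E^L_X(w)=\{a:aw\in\mathcal{L}(X)\}$, $E^R_X(w)=\{b:wb\in\mathcal{L}(X)\}$; $\mathcal{E}_X(w)$ is the bipartite graph on disjoint copies of these with an edge $\{a^L,b^R\}$ whenever $awb\in\mathcal{L}(X)$; $w$ is dendric if $\mathcal{E}_X(w)$ is a tree; $X$ is dendric if all its words are dendric and eventually dendric if all words of length at least some $N$ are dendric. For nonempty $w\in\mathcal{L}(X)$, a return word to $w$ is a nonempty word $r$ with $rw\in\mathcal{L}(X)$ such that $rw$ contains exactly two occurrences of $w$, one as prefix and one as suffix; for minimal $X$ the set $\mathcal{R}_X(w)$ of return words is finite. Let $R(w)=\{1,\dots,|\mathcal{R}_X(w)|\}$ and let $\theta:R(w)^*\to\mathcal{A}^*$ be a morphism mapping $R(w)$ bijectively onto $\mathcal{R}_X(w)$ (a coding morphism). The derived shift is $\mathcal{D}_w(X)=\{x\in R(w)^{\mathbb{Z}}:\theta(x)\in X\}$ (defined up to a permutation of $R(w)$).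 *)

theory Defs
  imports Main
begin

section \<open>Shift spaces over a finite alphabet A (configurations int => 'a)\<close>

definition configs :: "'a set \<Rightarrow> (int \<Rightarrow> 'a) set" where
  "configs A = {x. \<forall>i. x i \<in> A}"

definition shift_map :: "(int \<Rightarrow> 'a) \<Rightarrow> (int \<Rightarrow> 'a)" where
  "shift_map x = (\<lambda>i. x (i + 1))"

text \<open>Closedness in the product topology on A^Z (A discrete), written out:
  a configuration all of whose central windows occur in X belongs to X.\<close>
definition shift_closed :: "'a set \<Rightarrow> (int \<Rightarrow> 'a) set \<Rightarrow> bool" where
  "shift_closed A X \<longleftrightarrow>
     (\<forall>x \<in> configs A. (\<forall>n::nat. \<exists>y\<in>X. \<forall>i. \<bar>i\<bar> \<le> int n \<longrightarrow> y i = x i) \<longrightarrow> x \<in> X)"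

definition shift_space :: "'a set \<Rightarrow> (int \<Rightarrow> 'a) set \<Rightarrow> bool" where
  "shift_space A X \<longleftrightarrow> X \<noteq> {} \<and> X \<subseteq> configs A \<and> shift_map ` X = X \<and> shift_closed A X"

definition minimal_shift :: "'a set \<Rightarrow> (int \<Rightarrow> 'a) set \<Rightarrow> bool" where
  "minimal_shift A X \<longleftrightarrow> shift_space A X \<and> (\<forall>Y. Y \<subseteq> X \<and> shift_space A Y \<longrightarrow> Y = X)"

section \<open>Language\<close>

definition word_at :: "(int \<Rightarrow> 'a) \<Rightarrow> int \<Rightarrow> nat \<Rightarrow> 'a list" where
  "word_at x i n = map (\<lambda>k. x (i + int k)) [0..<n]"

definition language :: "(int \<Rightarrow> 'a) set \<Rightarrow> 'a list set" where
  "language X = {w. \<exists>x\<in>X. \<exists>i. w = word_at x i (length w)}"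

section \<open>Finite simple undirected graphs and trees\<close>

definition graph_connected :: "'v set \<Rightarrow> ('v \<Rightarrow> 'v \<Rightarrow> bool) \<Rightarrow> bool" where
  "graph_connected V adj \<longleftrightarrow>
     (\<forall>u\<in>V. \<forall>v\<in>V. (u, v) \<in> {(p, q). p \<in> V \<and> q \<in> V \<and> adj p q}\<^sup>*)"

definition graph_has_cycle :: "'v set \<Rightarrow> ('v \<Rightarrow> 'v \<Rightarrow> bool) \<Rightarrow> bool" where
  "graph_has_cycle V adj \<longleftrightarrow>
     (\<exists>vs. length vs \<ge> 3 \<and> distinct vs \<and> set vs \<subseteq> V \<and>
        (\<forall>i < length vs. adj (vs ! i) (vs ! ((i + 1) mod length vs))))"

definition is_tree :: "'v set \<Rightarrow> ('v \<Rightarrow> 'v \<Rightarrow> bool) \<Rightarrow> bool" where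
  "is_tree V adj \<longleftrightarrow> V \<noteq> {} \<and> graph_connected V adj \<and> \<not> graph_has_cycle V adj"

section \<open>Extension graphs and dendricity\<close>

definition ext_left :: "(int \<Rightarrow> 'a) set \<Rightarrow> 'a list \<Rightarrow> 'a set" where
  "ext_left X w = {a. a # w \<in> language X}"

definition ext_right :: "(int \<Rightarrow> 'a) set \<Rightarrow> 'a list \<Rightarrow> 'a set" where
  "ext_right X w = {b. w @ [b] \<in> language X}"

text \<open>Vertices: Inl a for left extensions, Inr b for right extensions (disjoint copies).\<close>
definition ext_vertices :: "(int \<Rightarrow> 'a) set \<Rightarrow> 'a list \<Rightarrow> ('a + 'a) set" where
  "ext_vertices X w = Inl ` ext_left X w \<union> Inr ` ext_right X w"

definition ext_adj :: "(int \<Rightarrow> 'a) set \<Rightarrow> 'a list \<Rightarrow> ('a + 'a) \<Rightarrow> ('a + 'a) \<Rightarrow> bool" where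
  "ext_adj X w u v \<longleftrightarrow>
     (\<exists>a b. ((u = Inl a \<and> v = Inr b) \<or> (u = Inr b \<and> v = Inl a)) \<and> a # w @ [b] \<in> language X)"

definition dendric_word :: "(int \<Rightarrow> 'a) set \<Rightarrow> 'a list \<Rightarrow> bool" where
  "dendric_word X w \<longleftrightarrow> is_tree (ext_vertices X w) (ext_adj X w)"

definition dendric_shift :: "(int \<Rightarrow> 'a) set \<Rightarrow> bool" where
  "dendric_shift X \<longleftrightarrow> (\<forall>w \<in> language X. dendric_word X w)"

definition eventually_dendric :: "(int \<Rightarrow> 'a) set \<Rightarrow> bool" where
  "eventually_dendric X \<longleftrightarrow> (\<exists>N. \<forall>w \<in> language X. length w \<ge> N \<longrightarrow> dendric_word X w)"

section \<open>Return words and derived shifts\<close>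

definition occurrences :: "'a list \<Rightarrow> 'a list \<Rightarrow> nat set" where
  "occurrences u w = {i. i + length w \<le> length u \<and> take (length w) (drop i u) = w}"

definition return_words :: "(int \<Rightarrow> 'a) set \<Rightarrow> 'a list \<Rightarrow> 'a list set" where
  "return_words X w =
     {r. r \<noteq> [] \<and> r @ w \<in> language X \<and> occurrences (r @ w) w = {0, length r}}"

text \<open>A coding morphism, given by its values on the letters 1..card(R_X(w)).\<close>
definition coding_morphism :: "(int \<Rightarrow> 'a) set \<Rightarrow> 'a list \<Rightarrow> (nat \<Rightarrow> 'a list) \<Rightarrow> bool" where
  "coding_morphism X w \<theta> \<longleftrightarrow> bij_betw \<theta> {1..card (return_words X w)} (return_words X w)"

text \<open>Starting position of the block theta(x_n) inside theta(x), where theta(x_0) starts at 0.\<close>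
definition block_pos :: "(nat \<Rightarrow> 'a list) \<Rightarrow> (int \<Rightarrow> nat) \<Rightarrow> int \<Rightarrow> int" where
  "block_pos \<theta> x n =
     (if 0 \<le> n then (\<Sum>k\<in>{0..<n}. int (length (\<theta> (x k))))
      else - (\<Sum>k\<in>{n..<0}. int (length (\<theta> (x k)))))"

text \<open>theta(x) = y means y is the concatenation ... theta(x_-1) . theta(x_0) theta(x_1) ...\<close>
definition morphism_image :: "(nat \<Rightarrow> 'a list) \<Rightarrow> (int \<Rightarrow> nat) \<Rightarrow> (int \<Rightarrow> 'a) \<Rightarrow> bool" where
  "morphism_image \<theta> x y \<longleftrightarrow>
     (\<forall>n j. j < length (\<theta> (x n)) \<longrightarrow> y (block_pos \<theta> x n + int j) = \<theta> (x n) ! j)"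

definition derived_shift :: "(int \<Rightarrow> 'a) set \<Rightarrow> 'a list \<Rightarrow> (nat \<Rightarrow> 'a list) \<Rightarrow> (int \<Rightarrow> nat) set" where
  "derived_shift X w \<theta> =
     {x. (\<forall>i. x i \<in> {1..card (return_words X w)}) \<and> (\<exists>y\<in>X. morphism_image \<theta> x y)}"

end

theory Submission
  imports Defs "HOL-Library.Sublist"
begin

text \<open>
  Let \<open>R\<close> be the set of return words to \<open>w\<close>. For \<open>v\<close> in the language of the derived shift,
  the extension graph of \<open>v\<close> is the graph relating \<open>r\<close> in \<open>R\<close> on the left of \<open>u = \<theta>(v) w\<close> to
  \<open>q\<close> with \<open>w q\<close> in \<open>R w\<close> on its right.

  If all words of length at least \<open>|w|\<close> are dendric, this graph is obtained from a star by
  extending \<open>u\<close> letter by letter: extending a left vertex \<open>p\<close> replaces it by the vertices \<open>a p\<close>,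
  joined to the neighbours of \<open>p\<close> by a tree, and this preserves trees. The right side is
  treated in the same way.

  Conversely, a long word of \<open>X\<close> is \<open>p \<theta>(v) w s\<close> with \<open>v\<close> long, and its extension graph is a
  quotient of the subgraph of the extension graph of \<open>v\<close> given by the return words compatible with
  \<open>p\<close> and \<open>s\<close>. Subgraphs and quotients of trees need not be trees, but in a dendric shift the graphs
  of all long words are double stars (one left vertex adjacent to all right vertices, one right
  vertex adjacent to all left ones, no further edges), and these are stable under both operations.
\<close>

text \<open>Double stars arise from integrality. For a dendric word \<open>w\<close>, the number of
  left extensions minus one is distributed over the right extensions \<open>w @ [b]\<close>. Summing
  the squares of these excesses over all words of a given length yields natural numbers that cannot
  increase with the length. Once they are constant, each long \<open>w\<close> passes its whole
  excess to a single \<open>w @ [b]\<close>, so this \<open>b\<close> is adjacent to every left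
  letter. Reversal gives a left letter adjacent to every right letter, and the edge count of a tree
  leaves room for no other edge. The obstacle in passing from the derived shift to \<open>X\<close>
  is that a word of \<open>X\<close> begins and ends inside return words. Its partial ends select
  some of the return words, and only one letter of each selected word is visible, which merges
  vertices. Both directions work on words alone, through the equivalence between \<open>v\<close>
  being in the language of the derived shift and \<open>concat (map \<theta> v) @ w\<close> being in
  that of \<open>X\<close>. Compactness enters only where minimality is turned into uniform
  recurrence.\<close>

section \<open>Trees as connected relations of minimal size\<close>

text \<open>Connectivity via two-colourings: a colouring that is constant along edges is constant. Unlike
  the path formulation it passes to refinements of a graph without any path surgery.\<close>
definition colour_connected :: "'v set \<Rightarrow> ('v \<times> 'v) set \<Rightarrow> bool" where
  "colour_connected V E \<longleftrightarrow>
     (\<forall>f::'v \<Rightarrow> bool. (\<forall>(u, v)\<in>E. f u = f v) \<longrightarrow> (\<forall>u\<in>V. \<forall>v\<in>V. f u = f v))"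

text \<open>Take a vertex set \<open>W\<close> of maximal size that carries a tree. If
  \<open>W\<close> misses a vertex, the colouring by membership in \<open>W\<close> is not constant
  on \<open>V\<close>, so some edge crosses the boundary of \<open>W\<close> and could be
  added.\<close>

lemma spanning_tree:
  assumes "finite V" "V \<noteq> {}" "E \<subseteq> V \<times> V" "colour_connected V E"
  shows "\<exists>F\<subseteq>E. colour_connected V F \<and> card F + 1 = card V"
proof -
  define P where "P W \<longleftrightarrow> W \<subseteq> V \<and> W \<noteq> {} \<and>
     (\<exists>F\<subseteq>E \<inter> W \<times> W. colour_connected W F \<and> card F + 1 = card W)" for W
  obtain v0 where v0: "v0 \<in> V" using assms(2) by blast
  have "P {v0}"
    unfolding P_def colour_connected_def using v0
    by (intro conjI exI[of _ "{}"]) simp_all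
  moreover have "\<forall>W. P W \<longrightarrow> card W < Suc (card V)"
    unfolding P_def using assms(1) by (auto simp: less_Suc_eq_le intro: card_mono)
  ultimately obtain W where W: "P W" and max: "\<And>W'. P W' \<Longrightarrow> card W' \<le> card W"
    using ex_has_greatest_nat[of P "{v0}" card "Suc (card V)"] by blast
  obtain F where F: "F \<subseteq> E \<inter> W \<times> W" "colour_connected W F" "card F + 1 = card W"
    using W unfolding P_def by blast
  have WV: "W \<subseteq> V" "W \<noteq> {}" "finite W"
    using W assms(1) finite_subset unfolding P_def by auto
  have finF: "finite F" using F(1) WV(3) by (meson finite_SigmaI finite_subset le_infE)
  have "W = V"
  proof (rule ccontr)
    assume "W \<noteq> V"
    then obtain z where z: "z \<in> V" "z \<notin> W" using WV by blast
    obtain w where w: "w \<in> W" using WV by blast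
    have "\<not> (\<forall>(u, v)\<in>E. (u \<in> W) = (v \<in> W))"
      using assms(4)[unfolded colour_connected_def, rule_format, of "\<lambda>u. u \<in> W" w z] z w WV by auto
    then obtain a b where ab: "(a, b) \<in> E" "(a \<in> W) \<noteq> (b \<in> W)" by blast
    define c where "c = (if a \<in> W then b else a)"
    have c: "c \<in> V" "c \<notin> W" using ab assms(3) by (auto simp: c_def)
    have sub: "insert (a, b) F \<subseteq> E \<inter> insert c W \<times> insert c W"
      using ab F(1) by (auto simp: c_def)
    have conn: "colour_connected (insert c W) (insert (a, b) F)"
      unfolding colour_connected_def
    proof (intro allI impI)
      fix f :: "'a \<Rightarrow> bool"
      assume f: "\<forall>(u, v)\<in>insert (a, b) F. f u = f v"
      have W: "\<forall>u\<in>W. \<forall>v\<in>W. f u = f v"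
        using F(2) f unfolding colour_connected_def by auto
      moreover have "\<exists>v\<in>W. f c = f v" using f ab by (auto simp: c_def)
      ultimately show "\<forall>u\<in>insert c W. \<forall>v\<in>insert c W. f u = f v"
        by (metis insert_iff)
    qed
    have "(a, b) \<notin> F" using F(1) ab by auto
    then have "card (insert (a, b) F) + 1 = card (insert c W)"
      using F(3) finF WV(3) c(2) by simp
    then have "\<exists>F\<subseteq>E \<inter> insert c W \<times> insert c W.
        colour_connected (insert c W) F \<and> card F + 1 = card (insert c W)"
      using sub conn by (intro exI[of _ "insert (a, b) F"]) simp
    then have "P (insert c W)" unfolding P_def using c(1) WV(1) by simp
    from max[OF this] show False using c(2) WV(3) by simp
  qed
  then show ?thesis using F by blast
qed

text \<open>Prepend one step at a time; if the new vertex already lies on the path, cut the path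
  back to it.\<close>

lemma simple_path_of_rtrancl:
  assumes "(u, v) \<in> r\<^sup>*"
  shows "\<exists>vs. vs \<noteq> [] \<and> hd vs = u \<and> last vs = v \<and> distinct vs \<and>
           (\<forall>i. Suc i < length vs \<longrightarrow> (vs ! i, vs ! Suc i) \<in> r)"
  using assms
proof (induction rule: converse_rtrancl_induct)
  case base
  show ?case by (intro exI[of _ "[v]"]) auto
next
  case (step y z)
  then obtain vs where vs: "vs \<noteq> []" "hd vs = z" "last vs = v" "distinct vs"
    "\<And>i. Suc i < length vs \<Longrightarrow> (vs ! i, vs ! Suc i) \<in> r" by blast
  show ?case
  proof (cases "y \<in> set vs")
    case True
    then obtain k where k: "k < length vs" "vs ! k = y" by (meson in_set_conv_nth)
    show ?thesis
      by (intro exI[of _ "drop k vs"]) (use k vs in \<open>auto simp: hd_drop_conv_nth\<close>)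
  next
    case False
    have "((y # vs) ! i, (y # vs) ! Suc i) \<in> r" if "Suc i < length (y # vs)" for i
      using that vs step(1) by (cases i) (auto simp: hd_conv_nth)
    then show ?thesis
      by (intro exI[of _ "y # vs"]) (use vs False in auto)
  qed
qed

text \<open>A bipartite tree given by its edges alone, so without isolated vertices.\<close>
definition tree_rel :: "('a \<times> 'b) set \<Rightarrow> bool" where
  "tree_rel E \<longleftrightarrow> finite E \<and> E \<noteq> {} \<and>
     (\<forall>(f::'a \<Rightarrow> bool) g. (\<forall>(a, b)\<in>E. f a = g b) \<longrightarrow> (\<forall>a\<in>Domain E. \<forall>a'\<in>Domain E. f a = f a')) \<and>
     card E + 1 = card (Domain E) + card (Range E)"

lemma tree_relD:
  assumes "tree_rel E"
  shows "finite E" "E \<noteq> {}" "card E + 1 = card (Domain E) + card (Range E)"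
    "\<And>f g a a'. (\<And>a b. (a, b) \<in> E \<Longrightarrow> f a = g b) \<Longrightarrow> a \<in> Domain E \<Longrightarrow> a' \<in> Domain E \<Longrightarrow> (f a :: bool) = f a'"
  using assms unfolding tree_rel_def by blast+

lemma tree_relI:
  assumes "finite E" "E \<noteq> {}" "card E + 1 = card (Domain E) + card (Range E)"
    "\<And>f g a a'. (\<And>a b. (a, b) \<in> E \<Longrightarrow> f a = g b) \<Longrightarrow> a \<in> Domain E \<Longrightarrow> a' \<in> Domain E \<Longrightarrow> (f a :: bool) = f a'"
  shows "tree_rel E"
  unfolding tree_rel_def
proof (intro conjI allI impI ballI assms(1-3))
  fix f :: "'a \<Rightarrow> bool" and g a a'
  assume "\<forall>(a, b)\<in>E. f a = g b" "a \<in> Domain E" "a' \<in> Domain E"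
  then show "f a = f a'" using assms(4)[of f g a a'] by blast
qed

text \<open>Bridge from paths and cycles to colourings and counting. An edge outside a spanning tree
  closes a cycle; conversely, deleting an edge of a cycle keeps the graph connected, so a spanning
  tree survives with fewer edges than the graph has.\<close>

lemma tree_rel_is_tree_iff:
  fixes E :: "('a \<times> 'b) set"
  assumes fin: "finite E"
    and V: "V = Inl ` Domain E \<union> Inr ` Range E"
    and adj: "\<And>u v. adj u v \<longleftrightarrow> (\<exists>(a, b)\<in>E. (u = Inl a \<and> v = Inr b) \<or> (u = Inr b \<and> v = Inl a))"
  shows "is_tree V adj \<longleftrightarrow> tree_rel E"
proof -
  \<comment> \<open>\<open>G\<close> orients every edge from left to right, so each undirected edge
    is counted once.\<close>
  define G where "G = (\<lambda>(a, b). (Inl a :: 'a + 'b, Inr b :: 'a + 'b)) ` E"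
  have cardG: "card G = card E"
    unfolding G_def by (rule card_image) (auto simp: inj_on_def)
  have finV: "finite V" unfolding V using fin by (simp add: finite_Domain finite_Range)
  have cardV: "card V = card (Domain E) + card (Range E)"
    unfolding V using fin
    by (subst card_Un_disjoint) (auto simp: finite_Domain finite_Range card_image)
  have GV: "G \<subseteq> V \<times> V" unfolding G_def V by auto
  have adjG: "adj u v \<longleftrightarrow> (u, v) \<in> G \<or> (v, u) \<in> G" for u v
    unfolding adj G_def by (auto simp: image_iff) force+
  have Gor: "(u, v) \<in> G \<Longrightarrow> (v, u) \<notin> G \<and> u \<noteq> v" for u v unfolding G_def by auto
  have ne: "V \<noteq> {} \<longleftrightarrow> E \<noteq> {}" unfolding V by auto
  have colE: "colour_connected V G \<longleftrightarrow> (\<forall>(f::'a \<Rightarrow> bool) g. (\<forall>(a, b)\<in>E. f a = g b) \<longrightarrow>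
       (\<forall>a\<in>Domain E. \<forall>a'\<in>Domain E. f a = f a'))" (is "?l \<longleftrightarrow> ?r")
  proof
    assume l: ?l
    show ?r
    proof (intro allI impI)
      fix f :: "'a \<Rightarrow> bool" and g
      assume "\<forall>(a, b)\<in>E. f a = g b"
      then have "\<forall>(u, v)\<in>G. case_sum f g u = case_sum f g v" unfolding G_def by auto
      then have "\<forall>u\<in>V. \<forall>v\<in>V. case_sum f g u = case_sum f g v"
        using l unfolding colour_connected_def by blast
      then show "\<forall>a\<in>Domain E. \<forall>a'\<in>Domain E. f a = f a'"
        unfolding V ball_Un ball_simps sum.case by blast
    qed
  next
    assume r: ?r
    show ?l
      unfolding colour_connected_def
    proof (intro allI impI)
      fix h :: "'a + 'b \<Rightarrow> bool"
      assume "\<forall>(u, v)\<in>G. h u = h v"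
      then have h: "\<forall>(a, b)\<in>E. h (Inl a) = h (Inr b)" unfolding G_def by auto
      then have 1: "\<forall>a\<in>Domain E. \<forall>a'\<in>Domain E. h (Inl a) = h (Inl a')"
        using r[THEN spec, of "\<lambda>a. h (Inl a)", THEN spec, of "\<lambda>b. h (Inr b)"] by (rule rev_mp)
      have "\<exists>a\<in>Domain E. h u = h (Inl a)" if "u \<in> V" for u using that h unfolding V by fastforce
      with 1 show "\<forall>u\<in>V. \<forall>v\<in>V. h u = h v" by metis
    qed
  qed
  have reach: "(u, v) \<in> {(p, q). p \<in> V \<and> q \<in> V \<and> ((p, q) \<in> F \<or> (q, p) \<in> F)}\<^sup>*"
    if F: "colour_connected V F" "F \<subseteq> V \<times> V" and uv: "u \<in> V" "v \<in> V" for F u v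
  proof -
    let ?R = "{(p, q). p \<in> V \<and> q \<in> V \<and> ((p, q) \<in> F \<or> (q, p) \<in> F)}"
    \<comment> \<open>Reachability from \<open>u\<close> is a colouring that is constant along the
      edges of \<open>F\<close>.\<close>
    have "\<forall>(p, q)\<in>F. ((u, p) \<in> ?R\<^sup>*) = ((u, q) \<in> ?R\<^sup>*)"
    proof (intro ballI, clarify)
      fix p q assume pq: "(p, q) \<in> F"
      then have "(p, q) \<in> ?R" "(q, p) \<in> ?R" using F(2) by auto
      then show "((u, p) \<in> ?R\<^sup>*) = ((u, q) \<in> ?R\<^sup>*)" by (meson rtrancl.rtrancl_into_rtrancl)
    qed
    with F(1)[unfolded colour_connected_def, THEN spec, of "\<lambda>q. (u, q) \<in> ?R\<^sup>*"]
    have "\<forall>p\<in>V. \<forall>q\<in>V. ((u, p) \<in> ?R\<^sup>*) = ((u, q) \<in> ?R\<^sup>*)" by (rule mp)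
    with uv have "((u, u) \<in> ?R\<^sup>*) = ((u, v) \<in> ?R\<^sup>*)" by blast
    then show ?thesis by simp
  qed
  have conn: "graph_connected V adj \<longleftrightarrow> colour_connected V G"
  proof
    assume c: "graph_connected V adj"
    show "colour_connected V G"
      unfolding colour_connected_def
    proof (intro allI impI ballI)
      fix f :: "'a + 'b \<Rightarrow> bool" and u v
      assume f: "\<forall>(u, v)\<in>G. f u = f v" and "u \<in> V" "v \<in> V"
      then have "(u, v) \<in> {(p, q). p \<in> V \<and> q \<in> V \<and> adj p q}\<^sup>*"
        using c unfolding graph_connected_def by blast
      then show "f u = f v"
        by (induction rule: rtrancl_induct) (use f in \<open>auto simp: adjG\<close>)
    qed
  next
    assume "colour_connected V G"
    from reach[OF this GV] show "graph_connected V adj"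
      unfolding graph_connected_def adjG by blast
  qed
  have acyc: "\<not> graph_has_cycle V adj \<longleftrightarrow> card G + 1 = card V"
    if c: "colour_connected V G" and Vne: "V \<noteq> {}"
  proof
    assume nc: "\<not> graph_has_cycle V adj"
    obtain F where F: "F \<subseteq> G" "colour_connected V F" "card F + 1 = card V"
      using spanning_tree[OF finV Vne GV c] by blast
    have "F = G"
    proof (rule ccontr)
      assume "F \<noteq> G"
      then obtain u v where uv: "(u, v) \<in> G" "(u, v) \<notin> F" using F(1) by auto
      let ?R = "{(p, q). p \<in> V \<and> q \<in> V \<and> ((p, q) \<in> F \<or> (q, p) \<in> F)}"
      have "(u, v) \<in> ?R\<^sup>*" using reach[OF F(2)] F(1) GV uv by blast
      from simple_path_of_rtrancl[OF this] obtain vs where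
        vs: "vs \<noteq> []" "hd vs = u" "last vs = v" "distinct vs"
        "\<And>i. Suc i < length vs \<Longrightarrow> (vs ! i, vs ! Suc i) \<in> ?R" by blast
      \<comment> \<open>The edge is missing from \<open>F\<close> in both orientations, which
        excludes a path with only two vertices.\<close>
      have uv2: "(u, v) \<notin> ?R" "u \<noteq> v" using uv Gor F(1) by blast+
      have len: "length vs \<ge> 3"
      proof (rule ccontr)
        assume "\<not> 3 \<le> length vs"
        then consider x where "vs = [x]" | x y where "vs = [x, y]"
          using vs(1) by (cases vs; cases "tl vs") (auto simp: Suc_le_eq)
        then show False
        proof cases
          case 1 then show False using vs uv2 by auto
        next
          case 2 then show False using vs(2,3) vs(5)[of 0] uv2 by auto
        qed
      qed
      have "set vs \<subseteq> V"
      proof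
        fix x assume "x \<in> set vs"
        then obtain i where i: "i < length vs" "x = vs ! i" by (metis in_set_conv_nth)
        show "x \<in> V"
        proof (cases "Suc i < length vs")
          case True then show ?thesis using vs(5)[of i] i by auto
        next
          case False
          then have "i = length vs - 1" using i by linarith
          then have "x = v" using i vs(1,3) by (simp add: last_conv_nth)
          then show ?thesis using uv GV by auto
        qed
      qed
      moreover have "adj (vs ! i) (vs ! ((i + 1) mod length vs))" if "i < length vs" for i
      proof (cases "Suc i < length vs")
        case True
        then have "(vs ! i, vs ! Suc i) \<in> F \<or> (vs ! Suc i, vs ! i) \<in> F" using vs(5) by auto
        with True F(1) show ?thesis unfolding adjG by auto
      next
        case False
        then have i: "Suc i = length vs" using that by simp
        then have "vs ! i = v" using vs(1,3) by (metis diff_Suc_1 last_conv_nth)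
        moreover have "vs ! ((i + 1) mod length vs) = u"
          using i vs(1,2) by (simp add: hd_conv_nth)
        ultimately show ?thesis unfolding adjG using uv by simp
      qed
      ultimately have "graph_has_cycle V adj"
        unfolding graph_has_cycle_def using len vs(4) by blast
      with nc show False by simp
    qed
    then show "card G + 1 = card V" using F by simp
  next
    assume cd: "card G + 1 = card V"
    show "\<not> graph_has_cycle V adj"
    proof
      assume "graph_has_cycle V adj"
      then obtain vs where vs: "length vs \<ge> 3" "distinct vs" "set vs \<subseteq> V"
        "\<And>i. i < length vs \<Longrightarrow> adj (vs ! i) (vs ! ((i + 1) mod length vs))"
        unfolding graph_has_cycle_def by blast
      define n where "n = length vs - 1"
      have n: "length vs = Suc n" "n \<ge> 2" using vs(1) by (auto simp: n_def)
      have "adj (vs ! n) (vs ! 0)" using vs(4)[of n] n by simp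
      then obtain e where e: "e \<in> G" "e = (vs ! n, vs ! 0) \<or> e = (vs ! 0, vs ! n)"
        unfolding adjG by blast
      have "colour_connected V (G - {e})"
        unfolding colour_connected_def
      proof (intro allI impI)
        fix f :: "'a + 'b \<Rightarrow> bool"
        assume f: "\<forall>(u, v)\<in>G - {e}. f u = f v"
        \<comment> \<open>Walk from \<open>vs ! 0\<close> to \<open>vs ! n\<close> along the cycle
          without using \<open>e\<close>; a length of at least 3 keeps the first edge apart from
          \<open>e\<close>.\<close>
        have "f (vs ! i) = f (vs ! 0)" if "i \<le> n" for i
          using that
        proof (induction i)
          case (Suc i)
          have "adj (vs ! i) (vs ! Suc i)" using vs(4)[of i] Suc n by simp
          moreover have "vs ! Suc i \<noteq> vs ! 0" "vs ! i = vs ! 0 \<longrightarrow> vs ! Suc i \<noteq> vs ! n"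
            using vs(2) Suc.prems n by (auto simp: nth_eq_iff_index_eq)
          ultimately have "(vs ! i, vs ! Suc i) \<in> G - {e} \<or> (vs ! Suc i, vs ! i) \<in> G - {e}"
            using e unfolding adjG by auto
          then have "f (vs ! i) = f (vs ! Suc i)" using f by auto
          with Suc show ?case by simp
        qed simp
        then have "\<forall>(u, v)\<in>G. f u = f v" using f e by fastforce
        with c show "\<forall>u\<in>V. \<forall>v\<in>V. f u = f v" unfolding colour_connected_def by blast
      qed
      then obtain F where F: "F \<subseteq> G - {e}" "card F + 1 = card V"
        using spanning_tree[OF finV Vne, of "G - {e}"] GV by blast
      have "finite G" unfolding G_def using fin by simp
      then have "card F < card G" using F(1) e(1) by (intro psubset_card_mono) auto
      then show False using F cd by simp
    qed
  qed
  show ?thesis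
    unfolding is_tree_def tree_rel_def conn colE[symmetric] cardG[symmetric] cardV[symmetric]
    using acyc ne fin by blast
qed

section \<open>Operations that preserve bipartite trees\<close>

lemma tree_rel_converse: "tree_rel E \<Longrightarrow> tree_rel (E\<inverse>)"
proof (rule tree_relI)
  assume t: "tree_rel E"
  note D = tree_relD[OF t]
  show "finite (E\<inverse>)" "E\<inverse> \<noteq> {}" "card (E\<inverse>) + 1 = card (Domain (E\<inverse>)) + card (Range (E\<inverse>))"
    using D(1-3) by auto
  fix f :: "'b \<Rightarrow> bool" and g a a'
  assume fg: "\<And>a b. (a, b) \<in> E\<inverse> \<Longrightarrow> f a = g b" and "a \<in> Domain (E\<inverse>)" "a' \<in> Domain (E\<inverse>)"
  then obtain b b' where b: "(b, a) \<in> E" "(b', a') \<in> E" by blast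
  have "g b = g b'" using D(4)[of g f b b'] fg b by blast
  then show "f a = f a'" using fg b by blast
qed

text \<open>Each left vertex \<open>a\<close> of the coarse graph is split into the fibre
  \<open>f r = a\<close>, which a tree joins to the neighbours of \<open>a\<close>. Adding up the
  edge counts of the fibres gives the count for \<open>E'\<close>. A colouring of \<open>E'\<close>
  is constant on every fibre and therefore descends to the coarse graph.\<close>

lemma tree_rel_refine:
  assumes fin: "finite E'"
    and tree: "tree_rel (map_prod f id ` E')"
    and fib: "\<And>a. a \<in> f ` Domain E' \<Longrightarrow> tree_rel {(r, s) \<in> E'. f r = a}"
  shows "tree_rel E'"
proof -
  define E where "E = map_prod f id ` E'"
  define Fib where "Fib a = {(r, s) \<in> E'. f r = a}" for a
  note D = tree_relD[OF tree, folded E_def]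
  have Dom: "Domain E = f ` Domain E'" unfolding E_def by force
  have Ran: "Range E = Range E'" unfolding E_def by force
  note DF = tree_relD[OF fib, folded Fib_def Dom]
  have finD: "finite (Domain E)" using D(1) by (rule finite_Domain)
  have finF: "finite (Fib a)" for a using fin unfolding Fib_def by (rule rev_finite_subset) auto
  have RF: "Range (Fib a) = E `` {a}" for a unfolding Fib_def E_def by force
  have "E' = (\<Union>a\<in>Domain E. Fib a)" unfolding Fib_def Dom by auto
  then have 1: "card E' = (\<Sum>a\<in>Domain E. card (Fib a))"
    using card_UN_disjoint[of "Domain E" Fib] finD finF unfolding Fib_def by fastforce
  have "Domain E' = (\<Union>a\<in>Domain E. Domain (Fib a))" unfolding Fib_def Dom by auto
  then have 2: "card (Domain E') = (\<Sum>a\<in>Domain E. card (Domain (Fib a)))"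
    using card_UN_disjoint[of "Domain E" "\<lambda>a. Domain (Fib a)", OF finD] finF[THEN finite_Domain]
    by (auto simp: Fib_def)
  have "E = (SIGMA a:Domain E. E `` {a})" by auto
  moreover have "finite (E `` {a})" for a
    by (rule finite_subset[OF _ finite_Range[OF D(1)]]) auto
  ultimately have 3: "card E = (\<Sum>a\<in>Domain E. card (E `` {a}))"
    using card_SigmaI[OF finD, of "\<lambda>a. E `` {a}"] by simp
  have "(\<Sum>a\<in>Domain E. card (Fib a) + 1) = (\<Sum>a\<in>Domain E. card (Domain (Fib a)) + card (E `` {a}))"
    using DF(3) unfolding RF by (intro sum.cong) auto
  then have "card E' + card (Domain E) = card (Domain E') + card E"
    unfolding 1 2 3 sum.distrib by simp
  then have cd: "card E' + 1 = card (Domain E') + card (Range E')"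
    using D(3) unfolding Ran by linarith
  show ?thesis
  proof (rule tree_relI[OF fin _ cd])
    show "E' \<noteq> {}" using D(2) unfolding E_def by auto
    fix h :: "'a \<Rightarrow> bool" and g a a'
    assume hg: "\<And>a b. (a, b) \<in> E' \<Longrightarrow> h a = g b" and a: "a \<in> Domain E'" "a' \<in> Domain E'"
    have const: "h x = h y" if "x \<in> Domain E'" "y \<in> Domain E'" "f x = f y" for x y
    proof (rule DF(4)[of "f x" h g x y])
      show "f x \<in> Domain E" "x \<in> Domain (Fib (f x))" "y \<in> Domain (Fib (f x))"
        using that unfolding Dom Fib_def by auto
    qed (auto simp: Fib_def hg)
    \<comment> \<open>The colouring induced on the coarse left vertices.\<close>
    define k where "k c \<longleftrightarrow> (\<exists>x\<in>Domain E'. f x = c \<and> h x)" for c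
    have k: "k (f x) = h x" if "x \<in> Domain E'" for x
      using const that unfolding k_def by blast
    have "k c = g b" if "(c, b) \<in> E" for c b
      using that k hg unfolding E_def by (auto simp: Domain.DomainI)
    from D(4)[of k g "f a" "f a'", OF this] show "h a = h a'" using a k unfolding Dom by auto
  qed
qed

lemma tree_rel_map_inj:
  assumes "tree_rel E" "inj_on f (Domain E)" "inj_on g (Range E)"
  shows "tree_rel (map_prod f g ` E)"
proof -
  note D = tree_relD[OF assms(1)]
  have "inj_on (map_prod f g) E"
    using assms(2,3) by (auto simp: inj_on_def) blast+
  then have c: "card (map_prod f g ` E) = card E" by (rule card_image)
  have Dom: "Domain (map_prod f g ` E) = f ` Domain E" by force
  have Ran: "Range (map_prod f g ` E) = g ` Range E" by force
  show ?thesis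
  proof (rule tree_relI)
    show "finite (map_prod f g ` E)" "map_prod f g ` E \<noteq> {}" using D by auto
    show "card (map_prod f g ` E) + 1 = card (Domain (map_prod f g ` E)) + card (Range (map_prod f g ` E))"
      unfolding c Dom Ran using D(3) assms(2,3) by (simp add: card_image)
    fix h :: "'c \<Rightarrow> bool" and k a a'
    assume hk: "\<And>a b. (a, b) \<in> map_prod f g ` E \<Longrightarrow> h a = k b"
      and a: "a \<in> Domain (map_prod f g ` E)" "a' \<in> Domain (map_prod f g ` E)"
    then obtain x x' where "a = f x" "a' = f x'" "x \<in> Domain E" "x' \<in> Domain E" unfolding Dom by blast
    then show "h a = h a'" using D(4)[of "h \<circ> f" "k \<circ> g" x x'] hk by fastforce
  qed
qed

lemma tree_rel_star:
  assumes "finite B" "B \<noteq> {}"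
  shows "tree_rel ({a} \<times> B)"
proof (rule tree_relI)
  show "card ({a} \<times> B) + 1 = card (Domain ({a} \<times> B)) + card (Range ({a} \<times> B))"
    using assms(2) by (simp add: card_cartesian_product Domain_fst Range_snd)
qed (use assms in auto)

lemma tree_rel_double_star:
  assumes "finite P" "finite Q" "a0 \<in> P" "b0 \<in> Q"
  shows "tree_rel (P \<times> {b0} \<union> {a0} \<times> Q)"
proof (rule tree_relI)
  let ?E = "P \<times> {b0} \<union> {a0} \<times> Q"
  have Dom: "Domain ?E = P" and Ran: "Range ?E = Q" using assms by auto
  \<comment> \<open>The two stars share exactly the edge \<open>(a0, b0)\<close>; removing
    \<open>b0\<close> from \<open>Q\<close> makes the union disjoint.\<close>
  have "?E = P \<times> {b0} \<union> {a0} \<times> (Q - {b0})" using assms by auto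
  then have "card ?E = card P + card (Q - {b0})"
    using assms by (subst \<open>?E = _\<close>, subst card_Un_disjoint) (auto simp: card_cartesian_product)
  then show "card ?E + 1 = card (Domain ?E) + card (Range ?E)"
    unfolding Dom Ran using assms card_Suc_Diff1[of Q b0] by simp
  show "finite ?E" "?E \<noteq> {}" using assms by auto
  fix f :: "'a \<Rightarrow> bool" and g a a'
  assume fg: "\<And>a b. (a, b) \<in> ?E \<Longrightarrow> f a = g b" and "a \<in> Domain ?E" "a' \<in> Domain ?E"
  then have "a \<in> P" "a' \<in> P" unfolding Dom by auto
  then show "f a = f a'" using fg by blast
qed

section \<open>Extension relations of a language\<close>

text \<open>Replacing the left letters by a suffix code, one letter at a time. \<open>M p s\<close> stands for
  \<open>p u s \<in> L\<close> with a fixed middle word \<open>u\<close>; completeness of the code is only required relative to \<open>M\<close>.\<close>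
lemma tree_rel_suffix_code:
  fixes M :: "'a list \<Rightarrow> 'b \<Rightarrow> bool"
  assumes finR: "finite R" and code: "\<And>r r'. r \<in> R \<Longrightarrow> r' \<in> R \<Longrightarrow> suffix r r' \<Longrightarrow> r = r'"
    and finM: "finite {s. \<exists>p. M p s}"
    and tl: "\<And>a p s. M (a # p) s \<Longrightarrow> M p s"
    and complete: "\<And>p s. M p s \<Longrightarrow> \<exists>r\<in>R. suffix r p \<or> suffix p r \<and> M r s"
    and local_tree: "\<And>p s. M p s \<Longrightarrow> (\<And>r. r \<in> R \<Longrightarrow> \<not> suffix r p) \<Longrightarrow> tree_rel {(a, s). M (a # p) s}"
    and ne: "M [] s0"
  shows "tree_rel {(r, s). r \<in> R \<and> M r s}"
proof -
  \<comment> \<open>\<open>T p\<close> keeps the code words ending in \<open>p\<close>, and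
    \<open>T []\<close> is the goal. The induction runs from long suffixes to short ones, with
    \<open>K\<close> bounding the length of a code word.\<close>
  define T where "T p = {(r, s). r \<in> R \<and> suffix p r \<and> M r s}" for p
  define K where "K = Max (length ` R)"
  have K: "length r \<le> K" if "r \<in> R" for r using that finR unfolding K_def by simp
  have drop_front: "M (z @ p) s \<Longrightarrow> M p s" for z p s by (induction z) (auto dest: tl)
  have finT: "finite (T p)" for p
    by (rule finite_subset[OF _ finite_cartesian_product[OF finR finM]]) (auto simp: T_def)
  have "tree_rel (T p)" if "\<exists>s. M p s" "\<And>r. r \<in> R \<Longrightarrow> suffix r p \<Longrightarrow> r = p" for p
    using that
  proof (induction "K - length p" arbitrary: p rule: less_induct)
    case less
    show ?case
    proof (cases "p \<in> R")
      case True
      then have "T p = {p} \<times> {s. M p s}" using code unfolding T_def by auto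
      moreover have "finite {s. M p s}" using finM by (rule finite_subset[rotated]) auto
      ultimately show ?thesis using tree_rel_star less.prems(1) by (metis empty_Collect_eq)
    next
      case False
      then have nos: "\<not> suffix r p" if "r \<in> R" for r using less.prems(2) that by blast
      \<comment> \<open>The letter of \<open>r\<close> just before its suffix \<open>p\<close>. It
        collapses \<open>T p\<close> onto the graph of one-letter extensions of \<open>p\<close>,
        with fibres \<open>T (a # p)\<close>.\<close>
      define f where "f r = last (take (length r - length p) r)" for r :: "'a list"
      have f: "f (z @ a # p) = a" for z a unfolding f_def by simp
      have expand: "\<exists>z a. r = z @ a # p" if "r \<in> R" "suffix p r" for r
        using that False by (auto elim!: suffixE) (metis append_Nil append_assoc append_Cons rev_exhaust)
      have TE: "(a, s) \<in> map_prod f id ` T p \<longleftrightarrow> M (a # p) s" for a s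
      proof
        assume "(a, s) \<in> map_prod f id ` T p"
        then obtain r where "r \<in> R" "suffix p r" "M r s" "a = f r" unfolding T_def by auto
        then show "M (a # p) s" using expand f drop_front by metis
      next
        assume m: "M (a # p) s"
        then obtain r where "r \<in> R" "suffix r (a # p) \<or> suffix (a # p) r \<and> M r s"
          using complete by blast
        then have r: "r \<in> R" "suffix (a # p) r" "M r s"
          using nos m by (auto simp: suffix_Cons)
        then have "f r = a" using f by (auto simp: suffix_def)
        moreover have "(r, s) \<in> T p" using r unfolding T_def by (auto simp: suffix_def)
        ultimately show "(a, s) \<in> map_prod f id ` T p" by force
      qed
      show ?thesis
      proof (rule tree_rel_refine[OF finT, where f = f])
        have "map_prod f id ` T p = {(a, s). M (a # p) s}" using TE by auto
        then show "tree_rel (map_prod f id ` T p)"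
          using local_tree less.prems(1) nos by metis
      next
        fix a assume "a \<in> f ` Domain (T p)"
        then obtain s where "(a, s) \<in> map_prod f id ` T p" by force
        then have m: "M (a # p) s" using TE by blast
        obtain r where r: "r \<in> R" "suffix p r"
          using less.prems(1) complete nos by blast
        then have "length p < length r" using expand by fastforce
        then have lt: "K - length (a # p) < K - length p" using K[OF r(1)] by simp
        have "{(r, s) \<in> T p. f r = a} = T (a # p)"
          using expand f unfolding T_def by (fastforce simp: suffix_def)
        moreover have "tree_rel (T (a # p))"
          by (rule less.hyps[OF lt]) (use m nos in \<open>auto simp: suffix_Cons\<close>)
        ultimately show "tree_rel {(r, s) \<in> T p. f r = a}" by simp
      qed
    qed
  qed
  from this[of "[]"] ne show ?thesis unfolding T_def by auto
qed

section \<open>Sums of squares and monotone sequences of naturals\<close>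

lemma sum_squares_le_square_sum:
  fixes x :: "'a \<Rightarrow> nat"
  assumes "finite B"
  shows "(\<Sum>b\<in>B. (x b)\<^sup>2) \<le> (\<Sum>b\<in>B. x b)\<^sup>2"
  using assms
proof (induction B)
  case (insert b B)
  then show ?case by (simp add: power2_sum)
qed simp

text \<open>Equality leaves no room for cross terms \<open>x b * x c\<close>, so at most one summand
  is nonzero.\<close>

lemma sum_squares_eq_square_sum:
  fixes x :: "'a \<Rightarrow> nat"
  assumes "finite B" "B \<noteq> {}" "(\<Sum>b\<in>B. (x b)\<^sup>2) = (\<Sum>b\<in>B. x b)\<^sup>2"
  shows "\<exists>b\<in>B. x b = (\<Sum>b\<in>B. x b)"
proof (cases "\<exists>b\<in>B. x b \<noteq> 0")
  case True
  then obtain c where c: "c \<in> B" "x c \<noteq> 0" by blast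
  define s where "s = (\<Sum>b\<in>B - {c}. x b)"
  have s: "(\<Sum>b\<in>B. x b) = x c + s"
    unfolding s_def using assms(1) c(1) by (rule sum.remove)
  have "(x c + s)\<^sup>2 = (x c)\<^sup>2 + (\<Sum>b\<in>B - {c}. (x b)\<^sup>2)"
    using assms(3) sum.remove[OF assms(1) c(1), of "\<lambda>b. (x b)\<^sup>2"] unfolding s by simp
  also have "\<dots> \<le> (x c)\<^sup>2 + s\<^sup>2"
    unfolding s_def using sum_squares_le_square_sum[of "B - {c}" x] assms(1) by simp
  finally have "s = 0" using c(2) by (simp add: power2_sum)
  then show ?thesis using s c by auto
next
  case False
  then show ?thesis using assms(2) by auto
qed

lemma antimono_nat_eventually_const:
  fixes q :: "nat \<Rightarrow> nat"
  assumes "\<And>n. N \<le> n \<Longrightarrow> q (Suc n) \<le> q n"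
  shows "\<exists>M\<ge>N. \<forall>n\<ge>M. q (Suc n) = q n"
proof -
  obtain M where M: "N \<le> M" "\<And>n. N \<le> n \<Longrightarrow> q M \<le> q n"
    using ex_has_least_nat[of "\<lambda>n. N \<le> n" N q] by auto
  have "q n = q M" if "M \<le> n" for n
    using that
  proof (induction n rule: dec_induct)
    case (step n)
    then show ?case using assms[of n] M(2)[of "Suc n"] M(1) by simp
  qed simp
  then show ?thesis using M(1) by (metis le_SucI)
qed

definition ext_rel :: "'a list set \<Rightarrow> 'a list \<Rightarrow> ('a \<times> 'a) set" where
  "ext_rel L w = {(a, b). a # w @ [b] \<in> L}"

text \<open>Separated from shift spaces so that the results apply equally to
  \<open>language X\<close>, to the language of a derived shift and to reversed languages.\<close>

locale ext_language =
  fixes L :: "'a list set" and A :: "'a set"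
  assumes finite_alphabet: "finite A"
    and alphabet: "w \<in> L \<Longrightarrow> set w \<subseteq> A"
    and factor: "xs @ ys @ zs \<in> L \<Longrightarrow> ys \<in> L"
    and extend_left: "w \<in> L \<Longrightarrow> \<exists>a. a # w \<in> L"
    and extend_right: "w \<in> L \<Longrightarrow> \<exists>b. w @ [b] \<in> L"
begin

lemma factor_left: "xs @ ys \<in> L \<Longrightarrow> xs \<in> L"
  using factor[of "[]" xs ys] by simp

lemma factor_right: "xs @ ys \<in> L \<Longrightarrow> ys \<in> L"
  using factor[of xs ys "[]"] by simp

lemma Domain_ext_rel: "Domain (ext_rel L w) = {a. a # w \<in> L}"
  using factor_left[of "_ # w"] extend_right[of "_ # w"] unfolding ext_rel_def by fastforce

lemma Range_ext_rel: "Range (ext_rel L w) = {b. w @ [b] \<in> L}"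
  using factor_right[of "[_]"] extend_left[of "w @ [_]"] unfolding ext_rel_def by fastforce

lemma finite_ext_rel: "finite (ext_rel L w)"
  by (rule finite_subset[OF _ finite_cartesian_product[OF finite_alphabet finite_alphabet]])
     (use alphabet in \<open>fastforce simp: ext_rel_def\<close>)

lemma finite_left: "finite {a. a # w \<in> L}"
  using finite_Domain[OF finite_ext_rel[of w]] unfolding Domain_ext_rel .

lemma finite_right: "finite {b. w @ [b] \<in> L}"
  using finite_Range[OF finite_ext_rel[of w]] unfolding Range_ext_rel .

lemma finite_words: "finite {w \<in> L. length w = n}"
  by (rule finite_subset[OF _ finite_lists_length_eq[OF finite_alphabet, of n]]) (use alphabet in auto)

lemma rev_ext_language: "ext_language (rev ` L) A"
proof
  show "finite A" by (rule finite_alphabet)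
next
  fix w assume "w \<in> rev ` L" then show "set w \<subseteq> A" using alphabet by fastforce
next
  fix xs ys zs assume "xs @ ys @ zs \<in> rev ` L"
  then have "rev zs @ rev ys @ rev xs \<in> L" by (auto simp: image_iff) (metis rev_append rev_rev_ident append_assoc)
  then have "rev ys \<in> L" by (rule factor)
  then show "ys \<in> rev ` L" by (metis image_eqI rev_rev_ident)
next
  fix w assume "w \<in> rev ` L"
  then obtain v where v: "v \<in> L" "w = rev v" by blast
  show "\<exists>a. a # w \<in> rev ` L" using extend_right[OF v(1)] v(2) by (metis image_eqI rev_eq_Cons_iff rev_rev_ident)
  show "\<exists>b. w @ [b] \<in> rev ` L" using extend_left[OF v(1)] v(2) by (metis image_eqI rev.simps(2))
qed

lemma rev_mem_iff: "rev w \<in> rev ` L \<longleftrightarrow> w \<in> L"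
  by (auto simp: image_iff)

lemma ext_rel_rev: "ext_rel (rev ` L) (rev w) = (ext_rel L w)\<inverse>"
proof -
  have "b # rev w @ [a] \<in> rev ` L \<longleftrightarrow> a # w @ [b] \<in> L" for a b
    using rev_mem_iff[of "a # w @ [b]"] by simp
  then show ?thesis unfolding ext_rel_def by auto
qed

text \<open>Count the edges of the tree by their right endpoint and subtract one per right letter.
  The left excess is thus conserved when \<open>w\<close> is extended to the right.\<close>

lemma sum_left_extensions:
  assumes "w \<in> L" "tree_rel (ext_rel L w)"
  shows "(\<Sum>b\<in>{b. w @ [b] \<in> L}. card {a. a # w @ [b] \<in> L} - 1) = card {a. a # w \<in> L} - 1"
proof -
  let ?B = "{b. w @ [b] \<in> L}"
  have "(ext_rel L w)\<inverse> = (SIGMA b:?B. {a. a # w @ [b] \<in> L})"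
    using factor_right[of "[_]"] unfolding ext_rel_def by fastforce
  then have "card (ext_rel L w) = (\<Sum>b\<in>?B. card {a. a # w @ [b] \<in> L})"
    using card_SigmaI[OF finite_right[of w], of "\<lambda>b. {a. a # w @ [b] \<in> L}"] finite_left
    by (metis (no_types) card_inverse)
  then have 1: "(\<Sum>b\<in>?B. card {a. a # w @ [b] \<in> L}) + 1 = card {a. a # w \<in> L} + card ?B"
    using tree_relD(3)[OF assms(2)] unfolding Domain_ext_rel Range_ext_rel by simp
  have "card {a. a # w @ [b] \<in> L} \<ge> 1" if "b \<in> ?B" for b
    using that extend_left[of "w @ [b]"] finite_left[of "w @ [b]"] by (auto simp: Suc_le_eq card_gt_0_iff)
  then have "(\<Sum>b\<in>?B. card {a. a # w @ [b] \<in> L}) = (\<Sum>b\<in>?B. (card {a. a # w @ [b] \<in> L} - 1) + 1)"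
    by (intro sum.cong refl) fastforce
  then have "(\<Sum>b\<in>?B. card {a. a # w @ [b] \<in> L}) = (\<Sum>b\<in>?B. card {a. a # w @ [b] \<in> L} - 1) + card ?B"
    unfolding sum.distrib card_eq_sum .
  moreover have "T = l - 1" if "S + 1 = l + B" "S = T + B" for S T l B :: nat using that by simp
  ultimately show ?thesis using 1 by blast
qed

lemma eventually_full_right_letter:
  assumes tree: "\<And>w. w \<in> L \<Longrightarrow> N \<le> length w \<Longrightarrow> tree_rel (ext_rel L w)"
  shows "\<exists>M\<ge>N. \<forall>w\<in>L. M \<le> length w \<longrightarrow>
           (\<exists>b. w @ [b] \<in> L \<and> (\<forall>a. a # w \<in> L \<longrightarrow> a # w @ [b] \<in> L))"
proof -
  define d where "d w = card {a. a # w \<in> L} - 1" for w :: "'a list"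
  \<comment> \<open>By \<open>sum_left_extensions\<close> the excess \<open>d\<close> is distributed over the right extensions, so the sum of its
    squares over all words of length \<open>n\<close> is nonincreasing. Once it is constant, no excess is split.\<close>
  define q where "q n = (\<Sum>w\<in>{w \<in> L. length w = n}. (d w)\<^sup>2)" for n
  have sum_d: "(\<Sum>b\<in>{b. w @ [b] \<in> L}. d (w @ [b])) = d w" if "w \<in> L" "N \<le> length w" for w
    using sum_left_extensions[OF that(1) tree[OF that]] unfolding d_def .
  \<comment> \<open>The share of \<open>q (Suc n)\<close> that comes from the right extensions of
    \<open>w\<close>.\<close>
  define q' where "q' w = (\<Sum>b\<in>{b. w @ [b] \<in> L}. (d (w @ [b]))\<^sup>2)" for w :: "'a list"
  have q': "q' w \<le> (d w)\<^sup>2" if "w \<in> L" "N \<le> length w" for w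
    using sum_squares_le_square_sum[where x = "\<lambda>b. d (w @ [b])", OF finite_right[of w]] sum_d[OF that]
    unfolding q'_def by simp
  have qSuc: "q (Suc n) = (\<Sum>w\<in>{w \<in> L. length w = n}. q' w)" for n
  proof -
    let ?S = "SIGMA w:{w \<in> L. length w = n}. {b. w @ [b] \<in> L}"
    have "inj_on (\<lambda>(w, b). w @ [b]) ?S" by (auto simp: inj_on_def)
    moreover have "(\<lambda>(w, b). w @ [b]) ` ?S = {w \<in> L. length w = Suc n}"
    proof (intro equalityI subsetI)
      fix v assume "v \<in> {w \<in> L. length w = Suc n}"
      then have "v \<noteq> []" "v \<in> L" "length v = Suc n" by auto
      then show "v \<in> (\<lambda>(w, b). w @ [b]) ` ?S"
        using factor_left[of "butlast v" "[last v]"] by (intro image_eqI[of _ _ "(butlast v, last v)"]) auto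
    qed auto
    ultimately have "q (Suc n) = (\<Sum>(w, b)\<in>?S. (d (w @ [b]))\<^sup>2)"
      unfolding q_def using sum.reindex[of "\<lambda>(w, b). w @ [b]" ?S "\<lambda>v. (d v)\<^sup>2"]
      by (simp add: case_prod_beta' comp_def)
    also have "\<dots> = (\<Sum>w\<in>{w \<in> L. length w = n}. q' w)"
      unfolding q'_def by (rule sum.Sigma[symmetric]) (auto simp: finite_words finite_right)
    finally show ?thesis .
  qed
  have "q (Suc n) \<le> q n" if "N \<le> n" for n
    unfolding qSuc unfolding q_def using q' that by (intro sum_mono) auto
  then obtain M where M: "N \<le> M" "\<And>n. M \<le> n \<Longrightarrow> q (Suc n) = q n"
    using antimono_nat_eventually_const[of N q] by blast
  have "\<exists>b. w @ [b] \<in> L \<and> (\<forall>a. a # w \<in> L \<longrightarrow> a # w @ [b] \<in> L)"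
    if w: "w \<in> L" "M \<le> length w" for w
  proof -
    let ?B = "{b. w @ [b] \<in> L}"
    have "(\<Sum>v\<in>{v \<in> L. length v = length w}. q' v) = (\<Sum>v\<in>{v \<in> L. length v = length w}. (d v)\<^sup>2)"
      using M(2)[OF w(2)] unfolding qSuc unfolding q_def .
    \<comment> \<open>Termwise inequality together with equal sums forces equality for every word of
      this length.\<close>
    then have "q' w = (d w)\<^sup>2"
      by (rule sum_mono_inv) (use q' w M(1) in \<open>auto simp: finite_words\<close>)
    then have "(\<Sum>b\<in>?B. (d (w @ [b]))\<^sup>2) = (\<Sum>b\<in>?B. d (w @ [b]))\<^sup>2"
      using sum_d[of w] w M(1) unfolding q'_def by simp
    moreover have "?B \<noteq> {}" using extend_right[OF w(1)] by auto
    ultimately obtain b where b: "w @ [b] \<in> L" "d (w @ [b]) = d w"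
      using sum_squares_eq_square_sum[where x = "\<lambda>b. d (w @ [b])", OF finite_right[of w]] sum_d[of w] w M(1)
      by auto
    have sub: "{a. a # w @ [b] \<in> L} \<subseteq> {a. a # w \<in> L}"
      using factor_left[of "_ # w" "[b]"] by auto
    \<comment> \<open>\<open>d\<close> is a truncated difference; equal values give equal cardinals
      because both are positive.\<close>
    have "card {a. a # w @ [b] \<in> L} \<ge> 1" "card {a. a # w \<in> L} \<ge> 1"
      using extend_left[OF b(1)] extend_left[OF w(1)] finite_left[of w] finite_left[of "w @ [b]"]
      by (auto simp: Suc_le_eq card_gt_0_iff)
    then have "card {a. a # w @ [b] \<in> L} = card {a. a # w \<in> L}" using b(2) unfolding d_def by simp
    then have "{a. a # w @ [b] \<in> L} = {a. a # w \<in> L}"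
      using sub finite_left by (metis card_subset_eq)
    then show ?thesis using b(1) by blast
  qed
  then show ?thesis using M(1) by blast
qed

lemma eventually_double_star:
  assumes tree: "\<And>w. w \<in> L \<Longrightarrow> N \<le> length w \<Longrightarrow> tree_rel (ext_rel L w)"
  shows "\<exists>M. \<forall>w\<in>L. M \<le> length w \<longrightarrow>
           (\<exists>P Q a b. a \<in> P \<and> b \<in> Q \<and> ext_rel L w = P \<times> {b} \<union> {a} \<times> Q)"
proof -
  interpret R: ext_language "rev ` L" A by (rule rev_ext_language)
  have treeR: "tree_rel (ext_rel (rev ` L) w)" if "w \<in> rev ` L" "N \<le> length w" for w
  proof -
    obtain v where "v \<in> L" "w = rev v" using \<open>w \<in> rev ` L\<close> by blast
    then show ?thesis using that(2) tree_rel_converse[OF tree] by (simp add: ext_rel_rev)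
  qed
  obtain M1 where M1: "M1 \<ge> N" "\<And>w. w \<in> L \<Longrightarrow> M1 \<le> length w \<Longrightarrow>
      \<exists>b. w @ [b] \<in> L \<and> (\<forall>a. a # w \<in> L \<longrightarrow> a # w @ [b] \<in> L)"
    using eventually_full_right_letter[OF tree] by blast
  obtain M2 where M2: "\<And>w. w \<in> rev ` L \<Longrightarrow> M2 \<le> length w \<Longrightarrow>
      \<exists>b. w @ [b] \<in> rev ` L \<and> (\<forall>a. a # w \<in> rev ` L \<longrightarrow> a # w @ [b] \<in> rev ` L)"
    using R.eventually_full_right_letter[OF treeR] by blast
  have "\<exists>P Q a b. a \<in> P \<and> b \<in> Q \<and> ext_rel L w = P \<times> {b} \<union> {a} \<times> Q"
    if w: "w \<in> L" "max M1 M2 \<le> length w" for w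
  proof -
    obtain b where b: "w @ [b] \<in> L" "\<And>a. a # w \<in> L \<Longrightarrow> a # w @ [b] \<in> L"
      using M1(2)[of w] w by auto
    obtain a where a: "rev w @ [a] \<in> rev ` L" "\<And>c. c # rev w \<in> rev ` L \<Longrightarrow> c # rev w @ [a] \<in> rev ` L"
      using M2[of "rev w"] w by auto
    have a1: "a # w \<in> L" using a(1) rev_mem_iff[of "a # w"] by simp
    have a2: "a # w @ [c] \<in> L" if "w @ [c] \<in> L" for c
      using a(2)[of c] rev_mem_iff[of "w @ [c]"] rev_mem_iff[of "a # w @ [c]"] that by simp
    let ?P = "{a. a # w \<in> L}" and ?Q = "{b. w @ [b] \<in> L}"
    let ?S = "?P \<times> {b} \<union> {a} \<times> ?Q"
    have "?S \<subseteq> ext_rel L w" using b(2) a2 by (auto simp: ext_rel_def)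
    moreover have "card ?S = card (ext_rel L w)"
    proof -
      have "card ?S + 1 = card (Domain ?S) + card (Range ?S)"
        using tree_rel_double_star[OF finite_left finite_right, of a w b w] a1 b(1)
        by (intro tree_relD(3)) simp
      moreover have "Domain ?S = ?P" "Range ?S = ?Q" using a1 b(1) by auto
      moreover have "card (ext_rel L w) + 1 = card ?P + card ?Q"
        using tree_relD(3)[OF tree[OF w(1)]] w M1(1) unfolding Domain_ext_rel Range_ext_rel by simp
      ultimately show ?thesis by simp
    qed
    ultimately have "ext_rel L w = ?S" using finite_ext_rel by (metis card_subset_eq)
    then show ?thesis using a1 b(1) by (intro exI[of _ ?P] exI[of _ ?Q] exI[of _ a] exI[of _ b]) simp
  qed
  then show ?thesis by blast
qed

end

section \<open>Return words in uniformly recurrent languages\<close>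

lemma occurrences_iff: "i \<in> occurrences u w \<longleftrightarrow> (\<exists>x y. u = x @ w @ y \<and> length x = i)"
proof
  assume "i \<in> occurrences u w"
  then have i: "i + length w \<le> length u" "take (length w) (drop i u) = w"
    unfolding occurrences_def by auto
  then have "u = take i u @ w @ drop (length w) (drop i u)"
    by (metis append_take_drop_id)
  moreover have "length (take i u) = i" using i(1) by simp
  ultimately show "\<exists>x y. u = x @ w @ y \<and> length x = i" by blast
next
  assume "\<exists>x y. u = x @ w @ y \<and> length x = i"
  then show "i \<in> occurrences u w" unfolding occurrences_def by auto
qed

lemma occurrences_append_left: "i \<in> occurrences u w \<Longrightarrow> length x + i \<in> occurrences (x @ u) w"
  unfolding occurrences_iff by (metis append_assoc length_append)

lemma occurrences_append_leftD: "length x + i \<in> occurrences (x @ u) w \<Longrightarrow> i \<in> occurrences u w"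
  unfolding occurrences_def by (auto simp: add.assoc)

lemma occurrences_rev:
  assumes "i \<in> occurrences u w"
  shows "length u - length w - i \<in> occurrences (rev u) (rev w)"
proof -
  obtain x y where "u = x @ w @ y" "length x = i" using assms unfolding occurrences_iff by blast
  then have "rev u = rev y @ rev w @ rev x" "length (rev y) = length u - length w - i" by auto
  then show ?thesis unfolding occurrences_iff by blast
qed

text \<open>\<open>return_words\<close> for a set of words instead of a shift, so that it also makes
  sense for the reversed language.\<close>

definition returns :: "'a list set \<Rightarrow> 'a list \<Rightarrow> 'a list set" where
  "returns L w = {r. r \<noteq> [] \<and> r @ w \<in> L \<and> occurrences (r @ w) w = {0, length r}}"

definition right_returns :: "'a list set \<Rightarrow> 'a list \<Rightarrow> 'a list set" where
  "right_returns L w = {q. q \<noteq> [] \<and> w @ q \<in> L \<and> occurrences (w @ q) w = {0, length q}}"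

lemma returnsD:
  assumes "r \<in> returns L w"
  shows "r \<noteq> []" "r @ w \<in> L" "\<And>x y. r @ w = x @ w @ y \<Longrightarrow> x = [] \<or> x = r"
    "prefix w (r @ w)"
proof -
  show "r \<noteq> []" "r @ w \<in> L" using assms unfolding returns_def by auto
  have o: "occurrences (r @ w) w = {0, length r}" using assms unfolding returns_def by auto
  show "x = [] \<or> x = r" if "r @ w = x @ w @ y" for x y
  proof -
    have "length x \<in> occurrences (r @ w) w" unfolding occurrences_iff using that by blast
    then show ?thesis using o that by (auto simp: append_eq_append_conv)
  qed
  have "0 \<in> occurrences (r @ w) w" using o by simp
  then show "prefix w (r @ w)" unfolding occurrences_iff by (auto simp: prefix_def)
qed

text \<open>If \<open>r' = z @ r\<close>, then \<open>w\<close> occurs in \<open>r' @ w\<close> at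
  position \<open>length z\<close>, because \<open>r @ w\<close> begins with \<open>w\<close>. A
  return word allows only the two end positions.\<close>

lemma returns_suffix_code:
  assumes "r \<in> returns L w" "r' \<in> returns L w" "suffix r r'"
  shows "r = r'"
proof -
  obtain z where z: "r' = z @ r" using assms(3) by (auto simp: suffix_def)
  obtain y where "r @ w = w @ y" using returnsD(4)[OF assms(1)] by (auto simp: prefix_def)
  then have "r' @ w = z @ w @ y" using z by simp
  then have "z = [] \<or> z = r'" using returnsD(3)[OF assms(2)] by blast
  then show ?thesis using z returnsD(1)[OF assms(1)] by auto
qed

text \<open>Makes the parsing of a configuration into return words unique: if \<open>r @ w\<close>
  is a prefix of \<open>r' @ w\<close>, then \<open>w\<close> occurs in \<open>r' @ w\<close> at the
  positive position \<open>length r\<close>, which must be \<open>length r'\<close>.\<close>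

lemma returns_prefix_unique:
  assumes "r \<in> returns L w" "r' \<in> returns L w" "prefix (r @ w) x" "prefix (r' @ w) x"
  shows "r = r'"
proof -
  have *: "r = r'" if r: "r \<in> returns L w" "r' \<in> returns L w" "prefix (r @ w) (r' @ w)" for r r'
  proof -
    obtain y where y: "r' @ w = r @ w @ y" using r(3) by (auto simp: prefix_def)
    then show ?thesis using returnsD(3)[OF r(2) y] returnsD(1)[OF r(1)] by blast
  qed
  from assms(3,4) have "prefix (r @ w) (r' @ w) \<or> prefix (r' @ w) (r @ w)"
    using prefix_same_cases by blast
  then show ?thesis using * assms(1,2) by metis
qed

text \<open>Reversal sends the occurrence of \<open>w\<close> at \<open>i\<close> to one at
  \<open>length q - i\<close>, exchanging the two end positions. Facts about the right side can thus
  be deduced from the left side.\<close>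

lemma right_returns_rev: "right_returns L w = rev ` returns (rev ` L) (rev w)"
proof -
  have inL: "rev x \<in> rev ` L \<longleftrightarrow> x \<in> L" for x by (auto simp: image_iff)
  have "q \<in> right_returns L w \<longleftrightarrow> rev q \<in> returns (rev ` L) (rev w)" for q
  proof -
    have "occurrences (w @ q) w = {0, length q} \<longleftrightarrow> occurrences (rev q @ rev w) (rev w) = {0, length q}"
      (is "?l \<longleftrightarrow> ?r")
    proof -
      have 1: "length q - i \<in> occurrences (rev q @ rev w) (rev w)" if "i \<in> occurrences (w @ q) w" for i
        using occurrences_rev[OF that] by simp
      have 2: "length q - i \<in> occurrences (w @ q) w" if "i \<in> occurrences (rev q @ rev w) (rev w)" for i
        using occurrences_rev[OF that] by simp
      have le: "i \<le> length q" if "i \<in> occurrences (w @ q) w \<or> i \<in> occurrences (rev q @ rev w) (rev w)" for i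
        using that unfolding occurrences_def by auto
      have 3: "i \<in> occurrences (w @ q) w \<longleftrightarrow> length q - i \<in> occurrences (rev q @ rev w) (rev w)"
        if "i \<le> length q" for i
        using 1[of i] 2[of "length q - i"] that by auto
      show ?thesis
      proof
        assume ?l
        show ?r
        proof (intro equalityI subsetI)
          fix i assume "i \<in> occurrences (rev q @ rev w) (rev w)"
          then have "length q - i \<in> {0, length q}" "i \<le> length q" using 2 le \<open>?l\<close> by blast+
          then show "i \<in> {0, length q}" by auto
        qed (use 3[of 0] 3[of "length q"] \<open>?l\<close> in auto)
      next
        assume ?r
        show ?l
        proof (intro equalityI subsetI)
          fix i assume "i \<in> occurrences (w @ q) w"
          then have "length q - i \<in> {0, length q}" "i \<le> length q" using 1 le \<open>?r\<close> by blast+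
          then show "i \<in> {0, length q}" by auto
        qed (use 3[of 0] 3[of "length q"] \<open>?r\<close> in auto)
      qed
    qed
    then show ?thesis unfolding right_returns_def returns_def using inL[of "w @ q"] by simp
  qed
  moreover have "q \<in> rev ` S \<longleftrightarrow> rev q \<in> S" for q :: "'a list" and S
    using imageI[of "rev q" S rev] by auto
  ultimately show ?thesis by blast
qed

lemma right_returns_prefix_code:
  assumes "q \<in> right_returns L w" "q' \<in> right_returns L w" "prefix q q'"
  shows "q = q'"
proof -
  have "rev q \<in> returns (rev ` L) (rev w)" "rev q' \<in> returns (rev ` L) (rev w)"
    using assms(1,2) unfolding right_returns_rev by auto
  moreover have "suffix (rev q) (rev q')" using assms(3) by (simp add: suffix_to_prefix)
  ultimately show ?thesis using returns_suffix_code by (metis rev_is_rev_conv)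
qed

text \<open>The return word \<open>r\<close> and the \<open>q\<close> with \<open>r w = w q\<close> determine each other.\<close>
definition conjugate :: "'a list \<Rightarrow> 'a list \<Rightarrow> 'a list" where
  "conjugate w r = drop (length w) (r @ w)"

lemma append_conjugate: "r \<in> returns L w \<Longrightarrow> w @ conjugate w r = r @ w"
  unfolding conjugate_def using returnsD(4) by (metis append_eq_conv_conj prefix_def)

text \<open>Since \<open>r @ w = w @ q\<close> forces equal lengths, \<open>r\<close> is recovered
  as the prefix of \<open>w @ q\<close> of length \<open>length q\<close>.\<close>

lemma bij_betw_conjugate: "bij_betw (conjugate w) (returns L w) (right_returns L w)"
proof (rule bij_betw_byWitness[where f' = "\<lambda>q. take (length q) (w @ q)"])
  show "\<forall>r\<in>returns L w. take (length (conjugate w r)) (w @ conjugate w r) = r"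
  proof
    fix r assume "r \<in> returns L w"
    from append_conjugate[OF this] have "w @ conjugate w r = r @ w" .
    moreover from arg_cong[OF this, of length] have "length (conjugate w r) = length r" by simp
    ultimately show "take (length (conjugate w r)) (w @ conjugate w r) = r" by simp
  qed
  have q: "take (length q) (w @ q) @ w = w @ q" if "q \<in> right_returns L w" for q
  proof -
    have "length q \<in> occurrences (w @ q) w" using that unfolding right_returns_def by simp
    then obtain x y where "w @ q = x @ w @ y" "length x = length q" unfolding occurrences_iff by blast
    moreover from arg_cong[OF this(1), of length] this(2) have "y = []" by simp
    ultimately show ?thesis by simp
  qed
  show "\<forall>q\<in>right_returns L w. conjugate w (take (length q) (w @ q)) = q"
    unfolding conjugate_def using q by simp
  show "conjugate w ` returns L w \<subseteq> right_returns L w"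
  proof clarify
    fix r assume r: "r \<in> returns L w"
    from append_conjugate[OF r] have e: "w @ conjugate w r = r @ w" .
    moreover from arg_cong[OF this, of length] have "length (conjugate w r) = length r" by simp
    ultimately show "conjugate w r \<in> right_returns L w"
      using r unfolding right_returns_def returns_def by auto
  qed
  show "(\<lambda>q. take (length q) (w @ q)) ` right_returns L w \<subseteq> returns L w"
  proof clarify
    fix x assume x: "x \<in> right_returns L w"
    have "take (length x) (w @ x) \<noteq> []" using x unfolding right_returns_def by auto
    moreover have "length (take (length x) (w @ x)) = length x" by simp
    ultimately show "take (length x) (w @ x) \<in> returns L w"
      using q[OF x] x unfolding right_returns_def returns_def by simp
  qed
qed

text \<open>Each \<open>r @ w\<close> begins with \<open>w\<close>, so \<open>w\<close> moves to the
  front one block at a time. This exposes a \<open>w\<close> at the left end of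
  \<open>concat rs @ w\<close>, where \<open>left_completion\<close> can be applied.\<close>

lemma prefix_concat_returns: "set rs \<subseteq> returns L w \<Longrightarrow> prefix w (concat rs @ w)"
proof (induction rs)
  case (Cons r rs)
  then obtain z where "concat rs @ w = w @ z" by (auto simp: prefix_def)
  moreover obtain y where "r @ w = w @ y" using Cons.prems returnsD(4)[of r L w] by (auto simp: prefix_def)
  ultimately have "concat (r # rs) @ w = w @ y @ z" by simp
  then show ?case by (metis prefixI)
qed simp

text \<open>Uniform recurrence is the form in which the arguments on words use minimality.\<close>

locale recurrent_language = ext_language +
  assumes recurrent: "w \<in> L \<Longrightarrow> \<exists>K. \<forall>u\<in>L. K \<le> length u \<longrightarrow> sublist w u"
begin

lemma rev_recurrent_language: "recurrent_language (rev ` L) A"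
proof -
  interpret R: ext_language "rev ` L" A by (rule rev_ext_language)
  show ?thesis
  proof
    fix w assume "w \<in> rev ` L"
    then obtain v where v: "v \<in> L" "w = rev v" by blast
    obtain K where "\<And>u. u \<in> L \<Longrightarrow> K \<le> length u \<Longrightarrow> sublist v u" using recurrent[OF v(1)] by blast
    then show "\<exists>K. \<forall>u\<in>rev ` L. K \<le> length u \<longrightarrow> sublist w u"
      using v(2) by (intro exI[of _ K]) (auto simp: sublist_rev_right)
  qed
qed

lemma extend_left_by: "w \<in> L \<Longrightarrow> \<exists>x. length x = n \<and> x @ w \<in> L"
proof (induction n)
  case (Suc n)
  then obtain x where "length x = n" "x @ w \<in> L" by blast
  moreover from extend_left[OF this(2)] obtain a where "(a # x) @ w \<in> L" by auto
  ultimately show ?case by (metis length_Cons)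
qed simp

lemma finite_returns:
  assumes "w \<in> L"
  shows "finite (returns L w)"
proof -
  obtain K where K: "\<And>u. u \<in> L \<Longrightarrow> K \<le> length u \<Longrightarrow> sublist w u" using recurrent[OF assms] by blast
  have "length r \<le> K + 1" if r: "r \<in> returns L w" for r
  proof (rule ccontr)
    assume "\<not> length r \<le> K + 1"
    then have len: "length r \<ge> K + 2" by simp
    \<comment> \<open>Both end letters of \<open>r\<close> are dropped, so that an occurrence of
      \<open>w\<close> in \<open>z\<close> starts neither at 0 nor at \<open>length r\<close> in
      \<open>r @ w\<close>.\<close>
    define z where "z = tl (butlast r)"
    have "r \<noteq> []" "butlast r \<noteq> []" using len by (auto simp flip: length_0_conv)
    then have rz: "r = hd r # z @ [last r]" unfolding z_def
      by (metis append_butlast_last_id append_Cons hd_append2 list.collapse)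
    have "[hd r] @ z @ ([last r] @ w) \<in> L" using returnsD(2)[OF r] rz by (metis append_Cons append_Nil append_assoc)
    then have "z \<in> L" by (rule factor)
    moreover have "K \<le> length z" unfolding z_def using len by simp
    ultimately obtain x y where xy: "z = x @ w @ y" using K unfolding sublist_def by blast
    have "r @ w = (hd r # x) @ w @ (y @ [last r] @ w)" using xy rz by (metis append_Cons append_assoc)
    then have "hd r # x = [] \<or> hd r # x = r" by (rule returnsD(3)[OF r])
    moreover have "length r > length (hd r # x)" using rz xy by (metis (no_types, lifting) length_Cons length_append le_imp_less_Suc length_append_singleton le_add1 Suc_mono)
    ultimately show False by auto
  qed
  moreover have "set r \<subseteq> A" if "r \<in> returns L w" for r using alphabet[OF returnsD(2)[OF that]] by simp
  ultimately show ?thesis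
    by (intro finite_subset[OF _ finite_lists_length_le[OF finite_alphabet, of "K + 1"]]) auto
qed

lemma finite_right_returns: "w \<in> L \<Longrightarrow> finite (right_returns L w)"
  using bij_betw_finite[OF bij_betw_conjugate] finite_returns by blast

text \<open>Extend \<open>p\<close> to the left until an earlier \<open>w\<close> appears, and cut
  at the last occurrence of \<open>w\<close> before the given one. The piece in between is a return
  word; it and \<open>p\<close> are suffixes of the same word, hence comparable. The right context
  \<open>t\<close> is carried along unchanged.\<close>

lemma left_completion:
  assumes w: "w \<noteq> []" and L: "p @ w @ t \<in> L"
  shows "\<exists>r\<in>returns L w. suffix r p \<or> suffix p r \<and> r @ w @ t \<in> L"
proof -
  have "w \<in> L" using L by (rule factor)
  then obtain K where K: "\<And>u. u \<in> L \<Longrightarrow> K \<le> length u \<Longrightarrow> sublist w u" using recurrent by blast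
  obtain x where x: "length x = K" "x @ p @ w @ t \<in> L" using extend_left_by[OF L] by blast
  define y where "y = x @ p"
  define Occ where "Occ = {i. i < length y \<and> i \<in> occurrences (y @ w) w}"
  have "x \<in> L" using x(2) by (rule factor_left)
  then obtain a b where ab: "x = a @ w @ b" using K x(1) unfolding sublist_def by blast
  have "length a \<in> occurrences (y @ w) w" unfolding occurrences_iff y_def ab by auto
  \<comment> \<open>Nonemptiness of \<open>w\<close> makes the occurrence found in \<open>x\<close>
    start strictly before the given one, even if nothing lies between them.\<close>
  moreover have "length a < length y" unfolding y_def ab using w by simp
  ultimately have "length a \<in> Occ" unfolding Occ_def by simp
  moreover have "finite Occ" unfolding Occ_def by simp
  ultimately have d: "Max Occ \<in> Occ" "\<And>i. i \<in> Occ \<Longrightarrow> i \<le> Max Occ" using Max_in[of Occ] by (blast, simp)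
  define d where "d = Max Occ"
  define r where "r = drop d y"
  have dy: "d < length y" "d \<in> occurrences (y @ w) w" using d(1) unfolding d_def Occ_def by auto
  have y: "y = take d y @ r" "length (take d y) = d" unfolding r_def using dy by auto
  have "occurrences (r @ w) w = {0, length r}"
  proof (intro equalityI subsetI)
    fix i assume i: "i \<in> occurrences (r @ w) w"
    have "d + i \<in> occurrences (y @ w) w"
      using occurrences_append_left[OF i, of "take d y"] y by (metis append_assoc)
    moreover have "d + i \<le> d" if "d + i \<in> Occ" using d(2)[OF that] unfolding d_def .
    ultimately have "i = 0 \<or> d + i \<ge> length y" unfolding Occ_def by auto
    moreover have "i \<le> length r" using i unfolding occurrences_def by auto
    moreover have "length y = d + length r" unfolding r_def using dy by simp
    ultimately show "i \<in> {0, length r}" by auto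
  next
    fix i assume "i \<in> {0, length r}"
    then consider "i = 0" | "i = length r" by auto
    then show "i \<in> occurrences (r @ w) w"
    proof cases
      case 1
      then show ?thesis using dy(2) occurrences_append_leftD[of "take d y" 0 "r @ w" w] y
        by (metis add.right_neutral append_assoc)
    next
      case 2 then show ?thesis unfolding occurrences_iff by (metis append_Nil2)
    qed
  qed
  moreover have "r \<noteq> []" unfolding r_def using dy(1) by simp
  moreover have rwt: "r @ w @ t \<in> L"
    using x(2) factor_right[of "take d y" "r @ w @ t"] y(1) unfolding y_def by (metis append_assoc)
  then have "r @ w \<in> L" using factor_left[of "r @ w" t] by simp
  ultimately have "r \<in> returns L w" unfolding returns_def by simp
  moreover have "suffix r y" "suffix p y" using y(1) by (metis suffixI) (simp add: y_def suffixI)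
  then have "suffix r p \<or> suffix p r" using suffix_same_cases by blast
  ultimately show ?thesis using rwt by blast
qed

lemma right_completion:
  assumes w: "w \<noteq> []" and L: "t @ w @ s \<in> L"
  shows "\<exists>q\<in>right_returns L w. prefix q s \<or> prefix s q \<and> t @ w @ q \<in> L"
proof -
  interpret R: recurrent_language "rev ` L" A by (rule rev_recurrent_language)
  have st: "rev s @ rev w @ rev t \<in> rev ` L" using rev_mem_iff[of "t @ w @ s"] L by simp
  then obtain r where r: "r \<in> returns (rev ` L) (rev w)"
    "suffix r (rev s) \<or> suffix (rev s) r \<and> r @ rev w @ rev t \<in> rev ` L"
    using R.left_completion[OF _ st] w by auto
  have "rev r \<in> right_returns L w" unfolding right_returns_rev using r(1) by simp
  moreover have "t @ w @ rev r \<in> L" if "r @ rev w @ rev t \<in> rev ` L"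
    using rev_mem_iff[of "t @ w @ rev r"] that by simp
  then have "prefix (rev r) s \<or> prefix s (rev r) \<and> t @ w @ rev r \<in> L"
    using r(2) by (auto simp: suffix_to_prefix)
  ultimately show ?thesis by blast
qed

section \<open>Growing extension graphs from letters to return words\<close>

text \<open>First stage: right letters grow into right returns while left vertices remain single
  letters. After reversal the right returns form a suffix code, and the local graphs are the
  converses of extension graphs of words \<open>u @ rev p\<close>, which are at least as long as
  \<open>u\<close>.\<close>

lemma tree_rel_right_returns:
  assumes tree: "\<And>x. x \<in> L \<Longrightarrow> N \<le> length x \<Longrightarrow> tree_rel (ext_rel L x)"
    and w: "w \<noteq> []" and u: "u \<in> L" "suffix w u" "N \<le> length u"
  shows "tree_rel {(a, q). q \<in> right_returns L w \<and> a # u @ q \<in> L}"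
proof -
  obtain t where t: "u = t @ w" using u(2) by (auto simp: suffix_def)
  have wL: "w \<in> L" using u(1) factor_right unfolding t by blast
  obtain a0 where a0: "a0 # u \<in> L" using extend_left[OF u(1)] by blast
  define M where "M y a \<longleftrightarrow> a # u @ rev y \<in> L" for y a
  define R where "R = rev ` right_returns L w"
  have "tree_rel {(y, a). y \<in> R \<and> M y a}"
  proof (rule tree_rel_suffix_code)
    show "finite R" unfolding R_def using finite_right_returns[OF wL] by simp
    show "r = r'" if "r \<in> R" "r' \<in> R" "suffix r r'" for r r'
      using that right_returns_prefix_code[of "rev r" L w "rev r'"]
      unfolding R_def by (auto simp: suffix_to_prefix)
    show "finite {s. \<exists>p. M p s}"
      by (rule finite_subset[OF _ finite_alphabet]) (use alphabet in \<open>fastforce simp: M_def\<close>)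
    show "M p s" if "M (a # p) s" for a p s
      using that factor_left[of "s # u @ rev p" "[a]"] unfolding M_def by simp
    show "\<exists>r\<in>R. suffix r p \<or> suffix p r \<and> M r s" if "M p s" for p s
    proof -
      have "(s # t) @ w @ rev p \<in> L" using that unfolding M_def t by simp
      from right_completion[OF w this] obtain q where
        "q \<in> right_returns L w" "prefix q (rev p) \<or> prefix (rev p) q \<and> (s # t) @ w @ q \<in> L" by blast
      then show ?thesis unfolding R_def M_def t
        by (intro bexI[of _ "rev q"]) (auto simp: suffix_to_prefix)
    qed
    show "tree_rel {(a, s). M (a # p) s}" if "M p s" for p s
    proof -
      have "u @ rev p \<in> L" using that factor_right[of "[s]" "u @ rev p"] unfolding M_def by simp
      then have "tree_rel (ext_rel L (u @ rev p))" using tree u(3) by simp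
      from tree_rel_converse[OF this] show ?thesis
        unfolding ext_rel_def M_def by (simp add: converse_unfold)
    qed
    show "M [] a0" unfolding M_def using a0 by simp
  qed
  from tree_rel_map_inj[OF tree_rel_converse[OF this], of id rev]
  have "tree_rel (map_prod id rev ` {(y, a). y \<in> R \<and> M y a}\<inverse>)" by (simp add: inj_on_def)
  moreover have "map_prod id rev ` {(y, a). y \<in> R \<and> M y a}\<inverse> =
    {(a, q). q \<in> right_returns L w \<and> a # u @ q \<in> L}"
    unfolding R_def M_def by (force simp: image_iff)
  ultimately show ?thesis by simp
qed

text \<open>Second stage: left letters grow into return words, with complete right returns as right
  vertices. The local tree at \<open>p\<close> is supplied by the first stage for the word
  \<open>p @ u\<close>.\<close>

lemma tree_rel_returns:
  assumes tree: "\<And>x. x \<in> L \<Longrightarrow> N \<le> length x \<Longrightarrow> tree_rel (ext_rel L x)"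
    and w: "w \<noteq> []" and u: "u \<in> L" "prefix w u" "suffix w u" "N \<le> length u"
  shows "tree_rel {(r, q). r \<in> returns L w \<and> q \<in> right_returns L w \<and> r @ u @ q \<in> L}"
proof -
  obtain t where t: "u = w @ t" using u(2) by (auto simp: prefix_def)
  obtain t' where t': "u = t' @ w" using u(3) by (auto simp: suffix_def)
  have wL: "w \<in> L" using u(1) factor_left unfolding t by blast
  define M where "M p q \<longleftrightarrow> q \<in> right_returns L w \<and> p @ u @ q \<in> L" for p q
  obtain q0 where q0: "q0 \<in> right_returns L w" "t' @ w @ q0 \<in> L"
    using right_completion[OF w, of t' "[]"] u(1) unfolding t' by (auto simp: right_returns_def)
  have "tree_rel {(r, q). r \<in> returns L w \<and> M r q}"
  proof (rule tree_rel_suffix_code)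
    show "finite (returns L w)" by (rule finite_returns[OF wL])
    show "r = r'" if "r \<in> returns L w" "r' \<in> returns L w" "suffix r r'" for r r'
      using returns_suffix_code that by blast
    show "finite {s. \<exists>p. M p s}"
      by (rule finite_subset[OF _ finite_right_returns[OF wL]]) (auto simp: M_def)
    show "M p s" if "M (a # p) s" for a p s
      using that factor_right[of "[a]" "p @ u @ s"] unfolding M_def by simp
    show "\<exists>r\<in>returns L w. suffix r p \<or> suffix p r \<and> M r s" if "M p s" for p s
      using left_completion[OF w, of p "t @ s"] that unfolding M_def t by auto
    show "tree_rel {(a, s). M (a # p) s}" if "M p s" for p s
    proof -
      have "p @ u \<in> L" using that factor_left[of "p @ u" s] unfolding M_def by simp
      moreover have "suffix w (p @ u)" using u(3) by (simp add: suffix_appendI)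
      moreover have "N \<le> length (p @ u)" using u(4) by simp
      ultimately have "tree_rel {(a, q). q \<in> right_returns L w \<and> a # (p @ u) @ q \<in> L}"
        using tree_rel_right_returns[of N w "p @ u", OF tree w] by blast
      then show ?thesis unfolding M_def by simp
    qed
    show "M [] q0" unfolding M_def using q0 t' by simp
  qed
  then show ?thesis unfolding M_def .
qed

end

section \<open>Transfer between a language and its derived language\<close>

context recurrent_language
begin

text \<open>As \<open>p\<close> and \<open>s\<close> contain no complete return word at their ends,
  every two-sided extension is read off a return word ending in \<open>a # p\<close> and a right
  return beginning with \<open>s @ [b]\<close>. Hence the graph is an image of the part of the
  double star compatible with \<open>p\<close> and \<open>s\<close>.\<close>

lemma tree_rel_of_derived_double_star:
  assumes w: "w \<noteq> []" and \<theta>: "bij_betw \<theta> I (returns L w)"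
    and u: "p @ concat (map \<theta> v) @ w @ s \<in> L"
    and p: "\<And>r. r \<in> returns L w \<Longrightarrow> \<not> suffix r p"
    and s: "\<And>q. q \<in> right_returns L w \<Longrightarrow> \<not> prefix q s"
    and v: "set v \<subseteq> I"
    and D: "\<And>v. v \<in> D \<longleftrightarrow> set v \<subseteq> I \<and> concat (map \<theta> v) @ w \<in> L"
    and star: "ext_rel D v = P \<times> {j0} \<union> {i0} \<times> Q" "i0 \<in> P" "j0 \<in> Q"
  shows "tree_rel (ext_rel L (p @ concat (map \<theta> v) @ w @ s))"
proof -
  define U where "U = concat (map \<theta> v)"
  \<comment> \<open>The letter of \<open>\<theta> i\<close> before its suffix \<open>p\<close>;
    likewise \<open>g j\<close> is the letter following the prefix \<open>s\<close>. Distinct return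
    words may show the same letter, which is why vertices merge.\<close>
  define f where "f i = last (take (length (\<theta> i) - length p) (\<theta> i))" for i
  define g where "g j = conjugate w (\<theta> j) ! length s" for j
  define P' where "P' = {i \<in> P. suffix p (\<theta> i)}"
  define Q' where "Q' = {j \<in> Q. prefix s (conjugate w (\<theta> j))}"
  have wL: "w \<in> L" using u factor[of "p @ concat (map \<theta> v)" w s] by simp
  have extD: "(i, j) \<in> ext_rel D v \<longleftrightarrow> i \<in> I \<and> j \<in> I \<and> \<theta> i @ U @ w @ conjugate w (\<theta> j) \<in> L" for i j
  proof (cases "i \<in> I \<and> j \<in> I")
    case True
    then have "w @ conjugate w (\<theta> j) = \<theta> j @ w"
      using append_conjugate bij_betw_apply[OF \<theta>] by blast
    then show ?thesis using True v unfolding ext_rel_def D U_def by simp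
  qed (auto simp: ext_rel_def D)
  have PQ: "P \<subseteq> I" "Q \<subseteq> I" using star extD by blast+
  have fin: "finite P" "finite Q"
    using PQ bij_betw_finite[OF \<theta>] finite_returns[OF wL] finite_subset by blast+
  have expand_f: "\<exists>z. \<theta> i = z @ f i # p" if i: "i \<in> P'" for i
  proof -
    obtain y where y: "\<theta> i = y @ p" using i unfolding P'_def suffix_def by auto
    have "\<theta> i \<in> returns L w" using i PQ bij_betw_apply[OF \<theta>] unfolding P'_def by blast
    from p[OF this] y have "y \<noteq> []" by auto
    then have "y = butlast y @ [f i]" unfolding f_def y by simp
    then show ?thesis using y by (metis append_Cons append_Nil append_assoc)
  qed
  have expand_g: "\<exists>z. conjugate w (\<theta> j) = s @ g j # z" if j: "j \<in> Q'" for j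
  proof -
    obtain y where y: "conjugate w (\<theta> j) = s @ y" using j unfolding Q'_def prefix_def by auto
    have "conjugate w (\<theta> j) \<in> right_returns L w"
      using j PQ bij_betw_apply[OF \<theta>] bij_betw_apply[OF bij_betw_conjugate] unfolding Q'_def by blast
    from s[OF this] y have "y \<noteq> []" by auto
    then have "y = g j # tl y" unfolding g_def y by (simp add: nth_append hd_conv_nth[symmetric])
    then show ?thesis using y by metis
  qed
  have ext: "ext_rel L (p @ U @ w @ s) = map_prod f g ` (ext_rel D v \<inter> P' \<times> Q')"
  proof (intro equalityI subsetI)
    fix x assume "x \<in> ext_rel L (p @ U @ w @ s)"
    then obtain a b where ab: "x = (a, b)" "(a # p) @ U @ w @ s @ [b] \<in> L"
      unfolding ext_rel_def by auto
    have "prefix w (U @ w)"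
      unfolding U_def using v bij_betw_apply[OF \<theta>] by (intro prefix_concat_returns[of _ L]) auto
    then obtain z where z: "U @ w = w @ z" by (auto simp: prefix_def)
    then have z': "U @ w @ y = w @ z @ y" for y by (metis append_assoc)
    have "(a # p) @ w @ z @ s @ [b] \<in> L" using ab(2) z' by metis
    from left_completion[OF w this] obtain r where r: "r \<in> returns L w"
      "suffix r (a # p) \<or> suffix (a # p) r \<and> r @ w @ z @ s @ [b] \<in> L" by blast
    then have r2: "suffix (a # p) r" "r @ U @ w @ s @ [b] \<in> L"
      using p[OF r(1)] ab(2) by (auto simp: suffix_Cons z')
    then have "(r @ U) @ w @ s @ [b] \<in> L" by simp
    from right_completion[OF w this] obtain q where q: "q \<in> right_returns L w"
      "prefix q (s @ [b]) \<or> prefix (s @ [b]) q \<and> (r @ U) @ w @ q \<in> L" by blast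
    then have q2: "prefix (s @ [b]) q" "r @ U @ w @ q \<in> L"
      using s[OF q(1)] r2(2) by auto
    obtain i where i: "i \<in> I" "\<theta> i = r" using r(1) bij_betw_imp_surj_on[OF \<theta>] by (metis imageE)
    obtain j where j: "j \<in> I" "conjugate w (\<theta> j) = q"
      using q(1) bij_betw_imp_surj_on[OF bij_betw_trans[OF \<theta> bij_betw_conjugate]] by (metis comp_apply imageE)
    have ij: "(i, j) \<in> ext_rel D v" using i j q2(2) extD by blast
    then have "i \<in> P" "j \<in> Q" using star by auto
    moreover have "suffix p r" "prefix s q"
      using r2(1) q2(1) suffix_ConsD append_prefixD by metis+
    ultimately have "i \<in> P'" "j \<in> Q'" unfolding P'_def Q'_def using i j by auto
    moreover have "f i = a" using r2(1) unfolding f_def i by (auto simp: suffix_def)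
    moreover have "g j = b" using q2(1) unfolding g_def j by (auto simp: prefix_def)
    ultimately show "x \<in> map_prod f g ` (ext_rel D v \<inter> P' \<times> Q')" using ij ab(1) by force
  next
    fix x assume "x \<in> map_prod f g ` (ext_rel D v \<inter> P' \<times> Q')"
    then obtain i j where ij: "x = (f i, g j)" "(i, j) \<in> ext_rel D v" "i \<in> P'" "j \<in> Q'" by auto
    obtain z where z: "\<theta> i = z @ f i # p" using expand_f[OF ij(3)] by blast
    obtain z' where z': "conjugate w (\<theta> j) = s @ g j # z'" using expand_g[OF ij(4)] by blast
    have "\<theta> i @ U @ w @ conjugate w (\<theta> j) \<in> L" using extD ij(2) by blast
    then have "z @ (f i # p @ U @ w @ s @ [g j]) @ z' \<in> L" unfolding z z' by simp
    then have "f i # p @ U @ w @ s @ [g j] \<in> L" by (rule factor)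
    then show "x \<in> ext_rel L (p @ U @ w @ s)" unfolding ext_rel_def ij(1) by simp
  qed
  have uL: "p @ U @ w @ s \<in> L" using u unfolding U_def .
  then have "ext_rel L (p @ U @ w @ s) \<noteq> {}"
    using extend_left Domain_ext_rel[of "p @ U @ w @ s"] by blast
  then have ne: "ext_rel D v \<inter> P' \<times> Q' \<noteq> {}" unfolding ext by auto
  have fin': "finite P'" "finite Q'" using fin unfolding P'_def Q'_def by auto
  have sub: "P' \<subseteq> P" "Q' \<subseteq> Q" unfolding P'_def Q'_def by auto
  \<comment> \<open>If both centres survive, a double star remains; if only one does, a star. Losing
    both would leave no edge, contradicting \<open>ne\<close>.\<close>
  have "tree_rel (map_prod f g ` (ext_rel D v \<inter> P' \<times> Q'))"
  proof (cases "i0 \<in> P'")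
    case i0: True
    show ?thesis
    proof (cases "j0 \<in> Q'")
      case True
      then have "ext_rel D v \<inter> P' \<times> Q' = P' \<times> {j0} \<union> {i0} \<times> Q'" using i0 star sub by auto
      then have "map_prod f g ` (ext_rel D v \<inter> P' \<times> Q') = f ` P' \<times> {g j0} \<union> {f i0} \<times> g ` Q'"
        by (simp add: image_Un map_prod_surj_on[OF refl refl])
      then show ?thesis
        using tree_rel_double_star[of "f ` P'" "g ` Q'" "f i0" "g j0"] fin' i0 True by simp
    next
      case False
      then have e: "ext_rel D v \<inter> P' \<times> Q' = {i0} \<times> Q'" using i0 star sub by auto
      then have "Q' \<noteq> {}" using ne by auto
      moreover have "map_prod f g ` (ext_rel D v \<inter> P' \<times> Q') = {f i0} \<times> g ` Q'"
        unfolding e by (simp add: map_prod_surj_on[OF refl refl])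
      ultimately show ?thesis using tree_rel_star[of "g ` Q'" "f i0"] fin' by simp
    qed
  next
    case False
    then have e: "ext_rel D v \<inter> P' \<times> Q' = P' \<times> ({j0} \<inter> Q')" using star sub by auto
    then have "P' \<noteq> {}" "j0 \<in> Q'" using ne by auto
    with e have "(map_prod f g ` (ext_rel D v \<inter> P' \<times> Q'))\<inverse> = {g j0} \<times> f ` P'" by force
    then show ?thesis
      using tree_rel_converse[OF tree_rel_star[of "f ` P'" "g j0"]] fin' \<open>P' \<noteq> {}\<close>
      by (metis converse_converse finite_imageI image_is_empty)
  qed
  then show ?thesis unfolding ext[symmetric] U_def .
qed

text \<open>Write a long \<open>u\<close> as \<open>p @ concat (map \<theta> v) @ w @ s\<close> with
  \<open>v\<close> as long as possible. Maximality keeps \<open>p\<close> and \<open>s\<close> free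
  of complete return words, so they are short and \<open>v\<close> is long enough for the double
  star.\<close>

lemma eventually_tree_rel_of_derived:
  assumes w: "w \<in> L" "w \<noteq> []" and \<theta>: "bij_betw \<theta> I (returns L w)"
    and D: "\<And>v. v \<in> D \<longleftrightarrow> set v \<subseteq> I \<and> concat (map \<theta> v) @ w \<in> L"
    and star: "\<And>v. v \<in> D \<Longrightarrow> M \<le> length v \<Longrightarrow>
      \<exists>P Q a b. a \<in> P \<and> b \<in> Q \<and> ext_rel D v = P \<times> {b} \<union> {a} \<times> Q"
  shows "\<exists>N. \<forall>u\<in>L. N \<le> length u \<longrightarrow> tree_rel (ext_rel L u)"
proof -
  obtain K where K: "\<And>u. u \<in> L \<Longrightarrow> K \<le> length u \<Longrightarrow> sublist w u" using recurrent[OF w(1)] by blast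
  define B where "B = Max (length ` (returns L w \<union> right_returns L w))"
  have B: "length r \<le> B" if "r \<in> returns L w \<union> right_returns L w" for r
    unfolding B_def using that finite_returns[OF w(1)] finite_right_returns[OF w(1)] by simp
  \<comment> \<open>\<open>K\<close> guarantees an occurrence of \<open>w\<close>. The blocks of
    \<open>v\<close> and the two ends contribute at most \<open>B * (length v + 2)\<close> letters,
    so this bound forces \<open>M \<le> length v\<close>.\<close>
  have "tree_rel (ext_rel L u)" if u: "u \<in> L" "K + B * (M + 2) + length w + 1 \<le> length u" for u
  proof -
    define R where "R n \<longleftrightarrow> (\<exists>p v s. length v = n \<and> set v \<subseteq> I \<and> u = p @ concat (map \<theta> v) @ w @ s)" for n
    have "sublist w u" using K u by simp
    then have R0: "R 0" unfolding R_def sublist_def by auto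
    have len: "length v \<le> length (concat (map \<theta> v))" if "set v \<subseteq> I" for v
      using that
    proof (induction v)
      case (Cons i v)
      then have "\<theta> i \<noteq> []" using returnsD(1) bij_betw_apply[OF \<theta>] by (metis insert_subset list.simps(15))
      then have "length (\<theta> i) \<ge> 1" by (simp add: Suc_le_eq)
      then show ?case using Cons by simp
    qed simp
    \<comment> \<open>Blocks are nonempty, so their number is bounded and a longest decomposition
      exists.\<close>
    have "n \<le> length u" if "R n" for n
      using that len unfolding R_def by (metis le_add1 le_add2 le_trans length_append)
    then obtain n where n: "R n" "\<And>m. R m \<Longrightarrow> m \<le> n"
      using R0 GreatestI_nat[of R 0] Greatest_le_nat[of R] by metis
    then obtain p v s where pvs: "length v = n" "set v \<subseteq> I" "u = p @ concat (map \<theta> v) @ w @ s"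
      unfolding R_def by blast
    have np: "\<not> suffix r p" if r: "r \<in> returns L w" for r
    proof
      assume "suffix r p"
      then obtain p' where p': "p = p' @ r" by (auto simp: suffix_def)
      obtain i where i: "i \<in> I" "r = \<theta> i" using r bij_betw_imp_surj_on[OF \<theta>] by (metis imageE)
      have "R (Suc n)" unfolding R_def
        by (intro exI[of _ p'] exI[of _ "i # v"] exI[of _ s]) (use pvs p' i in auto)
      from n(2)[OF this] show False by simp
    qed
    have ns: "\<not> prefix q s" if q: "q \<in> right_returns L w" for q
    proof
      assume "prefix q s"
      then obtain s' where s': "s = q @ s'" by (auto simp: prefix_def)
      obtain j where j: "j \<in> I" "q = conjugate w (\<theta> j)"
        using q bij_betw_imp_surj_on[OF bij_betw_trans[OF \<theta> bij_betw_conjugate]] by (metis comp_apply imageE)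
      then have "w @ q = \<theta> j @ w" using append_conjugate bij_betw_apply[OF \<theta>] by blast
      \<comment> \<open>Absorbing \<open>q\<close> moves the marked \<open>w\<close> one block to
        the right.\<close>
      then have "w @ s = \<theta> j @ w @ s'" unfolding s' by (metis append_assoc)
      then have "R (Suc n)" unfolding R_def
        by (intro exI[of _ p] exI[of _ "v @ [j]"] exI[of _ s']) (use pvs j in auto)
      from n(2)[OF this] show False by simp
    qed
    define U where "U = concat (map \<theta> v)"
    have "prefix w (U @ w)"
      unfolding U_def using pvs(2) bij_betw_apply[OF \<theta>] by (intro prefix_concat_returns[of _ L]) auto
    then obtain z where z: "U @ w = w @ z" by (auto simp: prefix_def)
    have "p @ w @ z @ s \<in> L" using u(1) z unfolding pvs(3) U_def by (metis append_assoc)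
    from left_completion[OF w(2) this] np obtain r where "r \<in> returns L w" "suffix p r" by blast
    then have lp: "length p \<le> B" using B[of r] suffix_length_le[of p r] by simp
    have "(p @ U) @ w @ s \<in> L" using u(1) unfolding pvs(3) U_def by simp
    from right_completion[OF w(2) this] ns obtain q where "q \<in> right_returns L w" "prefix s q" by blast
    then have ls: "length s \<le> B" using B[of q] prefix_length_le[of s q] by simp
    have "length U \<le> B * length v"
      unfolding U_def using pvs(2)
    proof (induction v)
      case (Cons i v)
      then have "length (\<theta> i) \<le> B" using B bij_betw_apply[OF \<theta>] by simp
      then show ?case using Cons by simp
    qed simp
    moreover have "length u = length p + length U + length w + length s" unfolding pvs(3) U_def by simp
    ultimately have "length u \<le> B * (length v + 2) + length w" using lp ls by simp
    then have "B * (M + 2) < B * (length v + 2)" using u(2) by linarith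
    then have Mv: "M \<le> length v" by simp
    have "U @ w \<in> L" using u(1) factor[of p "U @ w" s] unfolding pvs(3) U_def by simp
    then have "v \<in> D" unfolding D U_def using pvs(2) by simp
    from star[OF this Mv] obtain P Q a b where
      "a \<in> P" "b \<in> Q" "ext_rel D v = P \<times> {b} \<union> {a} \<times> Q" by blast
    then show ?thesis
      using tree_rel_of_derived_double_star[OF w(2) \<theta> _ np ns pvs(2) D] u(1) pvs(3) by metis
  qed
  then show ?thesis by blast
qed

text \<open>Because \<open>\<theta> j @ w = w @ conjugate w (\<theta> j)\<close>, an edge
  \<open>(i, j)\<close> at \<open>v\<close> says that \<open>\<theta> i\<close> and the conjugate of
  \<open>\<theta> j\<close> extend \<open>U\<close> on its two sides. The graph of \<open>v\<close>
  is therefore a relabelling of the one in \<open>tree_rel_returns\<close>.\<close>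

lemma tree_rel_derived:
  assumes tree: "\<And>x. x \<in> L \<Longrightarrow> N \<le> length x \<Longrightarrow> tree_rel (ext_rel L x)"
    and w: "w \<noteq> []" "N \<le> length w" and \<theta>: "bij_betw \<theta> I (returns L w)"
    and D: "\<And>v. v \<in> D \<longleftrightarrow> set v \<subseteq> I \<and> concat (map \<theta> v) @ w \<in> L"
    and v: "v \<in> D"
  shows "tree_rel (ext_rel D v)"
proof -
  define U where "U = concat (map \<theta> v) @ w"
  define G where "G = {(r, q). r \<in> returns L w \<and> q \<in> right_returns L w \<and> r @ U @ q \<in> L}"
  have vI: "set v \<subseteq> I" and U: "U \<in> L" using v unfolding D U_def by auto
  have "prefix w U"
    unfolding U_def using vI bij_betw_apply[OF \<theta>] by (intro prefix_concat_returns[of _ L]) auto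
  then have tG: "tree_rel G"
    unfolding G_def using tree_rel_returns[of N w U, OF tree w(1) U] w(2) unfolding U_def by (simp add: suffixI)
  define c where "c = conjugate w \<circ> \<theta>"
  have c: "bij_betw c I (right_returns L w)"
    unfolding c_def by (rule bij_betw_trans[OF \<theta> bij_betw_conjugate])
  have "(i, j) \<in> ext_rel D v \<longleftrightarrow> i \<in> I \<and> j \<in> I \<and> \<theta> i @ U @ c j \<in> L" for i j
  proof (cases "i \<in> I \<and> j \<in> I")
    case True
    then have "w @ conjugate w (\<theta> j) = \<theta> j @ w"
      using append_conjugate bij_betw_apply[OF \<theta>] by blast
    then show ?thesis using True vI unfolding ext_rel_def D U_def c_def by simp
  qed (auto simp: ext_rel_def D)
  then have E: "ext_rel D v = {(i, j). i \<in> I \<and> j \<in> I \<and> \<theta> i @ U @ c j \<in> L}" by auto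
  have "ext_rel D v = map_prod (inv_into I \<theta>) (inv_into I c) ` G" (is "_ = ?h ` G")
  proof (intro equalityI subsetI)
    fix x assume "x \<in> ext_rel D v"
    then obtain i j where ij: "x = (i, j)" "i \<in> I" "j \<in> I" "\<theta> i @ U @ c j \<in> L" unfolding E by auto
    then have "(\<theta> i, c j) \<in> G" unfolding G_def using bij_betw_apply[OF \<theta>] bij_betw_apply[OF c] by simp
    moreover have "?h (\<theta> i, c j) = x"
      using ij \<theta> c by (simp add: bij_betw_inv_into_left)
    ultimately show "x \<in> ?h ` G" by force
  next
    fix x assume "x \<in> ?h ` G"
    then obtain r q where rq: "x = ?h (r, q)" "r \<in> returns L w" "q \<in> right_returns L w" "r @ U @ q \<in> L"
      unfolding G_def by auto
    then show "x \<in> ext_rel D v"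
      unfolding E using bij_betw_inv_into_right[OF \<theta>] bij_betw_inv_into_right[OF c]
        bij_betw_apply[OF bij_betw_inv_into[OF \<theta>]] bij_betw_apply[OF bij_betw_inv_into[OF c]]
      by simp
  qed
  moreover have "inj_on (inv_into I \<theta>) (Domain G)"
    by (rule inj_on_subset[OF bij_betw_imp_inj_on[OF bij_betw_inv_into[OF \<theta>]]]) (auto simp: G_def)
  moreover have "inj_on (inv_into I c) (Range G)"
    by (rule inj_on_subset[OF bij_betw_imp_inj_on[OF bij_betw_inv_into[OF c]]]) (auto simp: G_def)
  ultimately show ?thesis using tree_rel_map_inj[OF tG] by simp
qed

end

section \<open>Minimal shift spaces and derived shifts\<close>

lemma length_word_at [simp]: "length (word_at x i n) = n"
  unfolding word_at_def by simp

lemma nth_word_at [simp]: "k < n \<Longrightarrow> word_at x i n ! k = x (i + int k)"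
  unfolding word_at_def by simp

lemma word_at_add: "word_at x i (m + n) = word_at x i m @ word_at x (i + int m) n"
  by (rule nth_equalityI) (auto simp: nth_append algebra_simps of_nat_diff)

lemma word_at_Suc: "word_at x i (Suc n) = x i # word_at x (i + 1) n"
  using word_at_add[of x i 1 n] by (simp add: word_at_def)

lemma word_at_append_iff:
  "word_at x i (length u + n) = u @ v \<longleftrightarrow> word_at x i (length u) = u \<and> word_at x (i + int (length u)) n = v"
  unfolding word_at_add by (simp add: append_eq_append_conv)

lemma mem_languageI: "x \<in> X \<Longrightarrow> word_at x i n \<in> language X"
  unfolding language_def by auto

lemma mem_languageE:
  assumes "w \<in> language X"
  obtains x i where "x \<in> X" "word_at x i (length w) = w"
  using assms that unfolding language_def by (auto dest: sym)

lemma ext_language_language: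
  assumes "finite A" "X \<subseteq> configs A"
  shows "ext_language (language X) A"
proof
  show "finite A" by fact
next
  fix w assume "w \<in> language X"
  then obtain x i where x: "x \<in> X" "word_at x i (length w) = w" by (rule mem_languageE)
  have "set (word_at x i (length w)) \<subseteq> A"
    using x(1) assms(2) unfolding word_at_def configs_def by auto
  then show "set w \<subseteq> A" using x(2) by simp
  have "x (i - 1) # w = word_at x (i - 1) (Suc (length w))" using x(2) by (simp add: word_at_Suc)
  then show "\<exists>a. a # w \<in> language X" using mem_languageI[OF x(1)] by metis
  have "w @ [x (i + int (length w))] = word_at x i (length w + 1)"
    unfolding word_at_add x(2) by (simp add: word_at_def)
  then show "\<exists>b. w @ [b] \<in> language X" using mem_languageI[OF x(1)] by metis
next
  fix xs ys zs assume "xs @ ys @ zs \<in> language X"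
  then obtain x i where x: "x \<in> X" "word_at x i (length (xs @ ys @ zs)) = xs @ ys @ zs"
    by (rule mem_languageE)
  then have "ys = word_at x (i + int (length xs)) (length ys)"
    by (simp add: word_at_append_iff)
  then show "ys \<in> language X" using mem_languageI[OF x(1)] by metis
qed

lemma dendric_word_iff:
  assumes "finite A" "X \<subseteq> configs A"
  shows "dendric_word X w \<longleftrightarrow> tree_rel (ext_rel (language X) w)"
proof -
  interpret ext_language "language X" A by (rule ext_language_language[OF assms])
  show ?thesis
    unfolding dendric_word_def
  proof (rule tree_rel_is_tree_iff[OF finite_ext_rel])
    show "ext_vertices X w = Inl ` Domain (ext_rel (language X) w) \<union> Inr ` Range (ext_rel (language X) w)"
      unfolding Domain_ext_rel Range_ext_rel ext_vertices_def ext_left_def ext_right_def ..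
  qed (auto simp: ext_adj_def ext_rel_def)
qed

lemma shift_invariant:
  assumes "shift_map ` X = X" "x \<in> X"
  shows "(\<lambda>i. x (i + k)) \<in> X"
proof (induction k rule: int_induct[where k = 0])
  case base
  then show ?case using assms(2) by simp
next
  case (step1 k)
  then have "shift_map (\<lambda>i. x (i + k)) \<in> X" using assms(1) by blast
  then show ?case unfolding shift_map_def by (simp add: algebra_simps)
next
  case (step2 k)
  then obtain y where y: "y \<in> X" "(\<lambda>i. x (i + k)) = shift_map y" using assms(1) by blast
  have "y i = x (i + (k - 1))" for i
    using fun_cong[OF y(2), of "i - 1"] unfolding shift_map_def by (simp add: algebra_simps)
  then have "y = (\<lambda>i. x (i + (k - 1)))" by blast
  then show ?case using y(1) by simp
qed

section \<open>Compactness and uniform recurrence\<close>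

text \<open>Diagonal argument: nested infinite index sets on which the sequence is constant on ever
  larger central windows. The conclusion has the form required by
  \<open>shift_closed\<close>.\<close>

lemma configs_cluster_point:
  fixes xs :: "nat \<Rightarrow> int \<Rightarrow> 'a"
  assumes finA: "finite A" and xs: "\<And>n. xs n \<in> configs A"
  shows "\<exists>z\<in>configs A. \<forall>k. \<exists>n\<ge>k. \<forall>i. \<bar>i\<bar> \<le> int k \<longrightarrow> xs n i = z i"
proof -
  define agree where "agree k S \<longleftrightarrow>
    infinite S \<and> (\<forall>m\<in>S. \<forall>n\<in>S. \<forall>i. \<bar>i\<bar> \<le> int k \<longrightarrow> xs m i = xs n i)" for k S
  have agreeD: "xs m i = xs n i" if "agree k S" "m \<in> S" "n \<in> S" "\<bar>i\<bar> \<le> int k" for k S m n i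
    using that unfolding agree_def by blast
  have refine: "\<exists>T. agree k T \<and> T \<subseteq> S" if S: "infinite S" for k S
  proof -
    define f where "f n = word_at (xs n) (- int k) (2 * k + 1)" for n
    have "f ` S \<subseteq> {w. set w \<subseteq> A \<and> length w = 2 * k + 1}"
      using xs unfolding f_def configs_def word_at_def by auto
    then have "finite (f ` S)" using finite_lists_length_eq[OF finA] finite_subset by blast
    then obtain a where a: "a \<in> S" "infinite {n \<in> S. f n = f a}"
      using pigeonhole_infinite[OF S] by blast
    have eq: "xs m i = xs n i" if "f m = f n" "\<bar>i\<bar> \<le> int k" for m n i
    proof -
      have "i = - int k + int (nat (i + int k))" "nat (i + int k) < 2 * k + 1" using that(2) by auto
      then show ?thesis using that(1) unfolding f_def by (metis nth_word_at)
    qed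
    have "agree k {n \<in> S. f n = f a}"
      unfolding agree_def
    proof (intro conjI ballI allI impI)
      show "infinite {n \<in> S. f n = f a}" by (rule a(2))
      show "xs m i = xs n i"
        if "m \<in> {n \<in> S. f n = f a}" "n \<in> {n \<in> S. f n = f a}" "\<bar>i\<bar> \<le> int k" for m n i
        using eq[of m n i] that by simp
    qed
    then show ?thesis by blast
  qed
  have "\<exists>S. \<forall>k. agree k (S k) \<and> S (Suc k) \<subseteq> S k"
  proof (rule dependent_nat_choice)
    show "\<exists>S. agree 0 S" using refine[OF infinite_UNIV_nat] by blast
    show "\<exists>T. agree (Suc k) T \<and> T \<subseteq> S" if "agree k S" for S k
      using refine[of S] that unfolding agree_def by blast
  qed
  then obtain S where S: "\<And>k. agree k (S k)" "\<And>k. S (Suc k) \<subseteq> S k" by blast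
  have mono: "S k \<subseteq> S j" if "j \<le> k" for j k
    using lift_Suc_antimono_le[of S, OF S(2) that] .
  define c where "c k = (SOME n. n \<in> S k)" for k
  have c: "c k \<in> S k" for k
    using S(1)[of k] unfolding c_def agree_def by (metis someI_ex infinite_imp_nonempty ex_in_conv)
  \<comment> \<open>All indices in \<open>S (nat \<bar>i\<bar>)\<close> give the same value at
    \<open>i\<close>, so the choice made by \<open>c\<close> does not matter.\<close>
  define z where "z i = xs (c (nat \<bar>i\<bar>)) i" for i
  have "\<exists>n\<ge>k. \<forall>i. \<bar>i\<bar> \<le> int k \<longrightarrow> xs n i = z i" for k
  proof -
    obtain n where n: "n \<ge> k" "n \<in> S k"
      using S(1)[of k] unfolding agree_def by (metis finite_nat_set_iff_bounded_le nle_le)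
    have "xs n i = z i" if "\<bar>i\<bar> \<le> int k" for i
    proof -
      have "nat \<bar>i\<bar> \<le> k" using that by linarith
      then have "n \<in> S (nat \<bar>i\<bar>)" using mono n(2) by blast
      then show ?thesis unfolding z_def by (intro agreeD[OF S(1) _ c]) simp_all
    qed
    then show ?thesis using n(1) by blast
  qed
  moreover have "z \<in> configs A" using xs unfolding z_def configs_def by auto
  ultimately show ?thesis by blast
qed

text \<open>If arbitrarily long words avoid \<open>w\<close>, centre them at the origin and pass to
  a cluster point: it avoids \<open>w\<close> entirely. The configurations of \<open>X\<close>
  avoiding \<open>w\<close> then form a nonempty shift space, which is proper since \<open>w\<close>
  occurs in \<open>X\<close>.\<close>

lemma minimal_shift_recurrent:
  assumes finA: "finite A" and min: "minimal_shift A X" and w: "w \<in> language X"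
  shows "\<exists>K. \<forall>u\<in>language X. K \<le> length u \<longrightarrow> sublist w u"
proof (rule ccontr)
  assume neg: "\<not> ?thesis"
  have X: "X \<subseteq> configs A" "shift_map ` X = X" "shift_closed A X"
    and minX: "\<And>Y. Y \<subseteq> X \<Longrightarrow> shift_space A Y \<Longrightarrow> Y = X"
    using min unfolding minimal_shift_def shift_space_def by auto
  have "\<exists>x\<in>X. \<not> sublist w (word_at x (- int n) (2 * n + 1))" for n
  proof -
    obtain u where u: "u \<in> language X" "2 * n + 1 \<le> length u" "\<not> sublist w u" using neg by blast
    obtain x i where x: "x \<in> X" "word_at x i (length u) = u" using u(1) by (rule mem_languageE)
    obtain m where m: "length u = (2 * n + 1) + m" using u(2) le_Suc_ex by blast
    define y where "y j = x (j + (i + int n))" for j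
    have "y \<in> X" unfolding y_def by (rule shift_invariant[OF X(2) x(1)])
    moreover have "word_at y (- int n) (2 * n + 1) = word_at x i (2 * n + 1)"
      by (rule nth_equalityI) (auto simp: y_def algebra_simps)
    moreover have "u = word_at x i (2 * n + 1) @ word_at x (i + int (2 * n + 1)) m"
      using x(2) m word_at_add[of x i "2 * n + 1" m] by simp
    then have "\<not> sublist w (word_at x i (2 * n + 1))"
      using u(3) sublist_order.order_trans sublist_append_rightI by metis
    ultimately show ?thesis by metis
  qed
  then obtain xs where xs: "\<And>n. xs n \<in> X" "\<And>n. \<not> sublist w (word_at (xs n) (- int n) (2 * n + 1))"
    by metis
  obtain z where z: "z \<in> configs A" "\<And>k. \<exists>n\<ge>k. \<forall>i. \<bar>i\<bar> \<le> int k \<longrightarrow> xs n i = z i"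
    using configs_cluster_point[OF finA, of xs] xs(1) X(1) by blast
  have "z \<in> X"
    using X(3) z xs(1) unfolding shift_closed_def by metis
  moreover have "word_at z i (length w) \<noteq> w" for i
  proof
    assume zi: "word_at z i (length w) = w"
    \<comment> \<open>Chosen so that the occurrence at \<open>i\<close> lies in the window of radius
      \<open>k\<close>, hence inside the central word of \<open>xs n\<close> that avoids
      \<open>w\<close>.\<close>
    define k where "k = nat \<bar>i\<bar> + length w"
    obtain n where n: "n \<ge> k" "\<And>j. \<bar>j\<bar> \<le> int k \<Longrightarrow> xs n j = z j" using z(2)[of k] by blast
    have "word_at (xs n) i (length w) = word_at z i (length w)"
      by (rule nth_equalityI) (use n(2) in \<open>auto simp: k_def\<close>)
    then have "word_at (xs n) i (length w) = w" using zi by simp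
    moreover define p where "p = nat (i + int n)"
    moreover have p: "i = - int n + int p" "p + length w \<le> 2 * n + 1"
      using n(1) unfolding p_def k_def by auto
    then have "word_at (xs n) (- int n) (2 * n + 1) = word_at (xs n) (- int n) (p + (length w + (2 * n + 1 - p - length w)))"
      by simp
    ultimately have "sublist w (word_at (xs n) (- int n) (2 * n + 1))"
      unfolding word_at_add sublist_def using p(1) by metis
    then show False using xs(2) by blast
  qed
  moreover define Y where "Y = {x \<in> X. \<forall>i. word_at x i (length w) \<noteq> w}"
  ultimately have "z \<in> Y" by simp
  have "shift_space A Y"
    unfolding shift_space_def
  proof (intro conjI)
    show "Y \<noteq> {}" using \<open>z \<in> Y\<close> by blast
    show "Y \<subseteq> configs A" using X(1) unfolding Y_def by blast
    have wa: "word_at (shift_map x) i n = word_at x (i + 1) n" for x :: "int \<Rightarrow> 'a" and i n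
      by (rule nth_equalityI) (auto simp: shift_map_def algebra_simps)
    show "shift_map ` Y = Y"
    proof (intro equalityI subsetI)
      fix x assume "x \<in> shift_map ` Y"
      then show "x \<in> Y" using X(2) unfolding Y_def by (auto simp: wa)
    next
      fix x assume x: "x \<in> Y"
      then obtain y where y: "y \<in> X" "x = shift_map y" using X(2) unfolding Y_def by blast
      have "word_at y i (length w) \<noteq> w" for i
      proof -
        have "word_at (shift_map y) (i - 1) (length w) \<noteq> w" using x unfolding Y_def y(2) by blast
        then show ?thesis unfolding wa by simp
      qed
      then show "x \<in> shift_map ` Y" using y unfolding Y_def by blast
    qed
    show "shift_closed A Y"
      unfolding shift_closed_def
    proof (intro ballI impI)
      fix x assume x: "x \<in> configs A" and appr: "\<forall>n. \<exists>y\<in>Y. \<forall>i. \<bar>i\<bar> \<le> int n \<longrightarrow> y i = x i"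
      have "x \<in> X" using X(3) x appr unfolding shift_closed_def Y_def by blast
      moreover have "word_at x i (length w) \<noteq> w" for i
      proof -
        obtain y where y: "y \<in> Y" "\<And>j. \<bar>j\<bar> \<le> int (nat \<bar>i\<bar> + length w) \<Longrightarrow> y j = x j"
          using appr by blast
        have "word_at x i (length w) = word_at y i (length w)"
          by (rule nth_equalityI) (use y(2) in auto)
        then show ?thesis using y(1) unfolding Y_def by auto
      qed
      ultimately show "x \<in> Y" unfolding Y_def by blast
    qed
  qed
  then have "Y = X" by (intro minX) (auto simp: Y_def)
  then show False using w unfolding Y_def by (elim mem_languageE) blast
qed

lemma recurrent_language_language:
  assumes "finite A" "minimal_shift A X"
  shows "recurrent_language (language X) A"
proof -
  have "X \<subseteq> configs A" using assms(2) unfolding minimal_shift_def shift_space_def by blast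
  then interpret ext_language "language X" A by (rule ext_language_language[OF assms(1)])
  show ?thesis by unfold_locales (rule minimal_shift_recurrent[OF assms])
qed

section \<open>Block positions, parsing into return words, and the derived language\<close>

lemma block_pos_step: "block_pos \<theta> x (n + 1) = block_pos \<theta> x n + int (length (\<theta> (x n)))"
proof (cases "0 \<le> n")
  case True
  then have "{0..<n + 1} = insert n {0..<n}" by auto
  then show ?thesis using True unfolding block_pos_def by simp
next
  case False
  then have e: "{n..<0} = insert n {n + 1..<0}" by auto
  then have "(\<Sum>k\<in>{n..<0}. int (length (\<theta> (x k)))) =
      int (length (\<theta> (x n))) + (\<Sum>k\<in>{n + 1..<0}. int (length (\<theta> (x k))))"
    unfolding e by (subst sum.insert) auto
  moreover have "block_pos \<theta> x (n + 1) = - (\<Sum>k\<in>{n + 1..<0}. int (length (\<theta> (x k))))"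
    using False unfolding block_pos_def by (cases "n + 1 = 0") auto
  ultimately show ?thesis using False unfolding block_pos_def by simp
qed

lemma word_at_block_pos:
  assumes "morphism_image \<theta> x y"
  shows "word_at y (block_pos \<theta> x n) (length (\<theta> (x n))) = \<theta> (x n)"
  using assms unfolding morphism_image_def by (intro nth_equalityI) auto

text \<open>The point is that \<open>w\<close> appears at every block position, although it may be
  longer than the next block. A letter of \<open>w\<close> beyond the block \<open>r\<close> equals
  an earlier letter of \<open>w\<close> because \<open>r @ w\<close> begins with \<open>w\<close>,
  and that letter is read from the next block position.\<close>

lemma word_at_morphism_image:
  assumes im: "morphism_image \<theta> x y" and r: "\<And>n. \<theta> (x n) \<in> returns L w"
  shows "word_at y (block_pos \<theta> x n) (length (concat (map \<theta> (word_at x n m)) @ w)) =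
           concat (map \<theta> (word_at x n m)) @ w"
proof -
  have "y (block_pos \<theta> x n + int k) = w ! k" if "k < length w" for n k
    using that
  proof (induction k arbitrary: n rule: less_induct)
    case (less k)
    let ?r = "\<theta> (x n)"
    obtain t where t: "?r @ w = w @ t" using returnsD(4)[OF r] by (auto simp: prefix_def)
    have wk: "w ! k = (?r @ w) ! k" unfolding t using less.prems by (simp add: nth_append)
    show ?case
    proof (cases "k < length ?r")
      case True
      then show ?thesis using im wk unfolding morphism_image_def by (simp add: nth_append)
    next
      case False
      have "0 < length ?r" using returnsD(1)[OF r] by blast
      then have "y (block_pos \<theta> x (n + 1) + int (k - length ?r)) = w ! (k - length ?r)"
        using False less.prems by (intro less.IH; linarith)
      then have "y (block_pos \<theta> x n + int k) = w ! (k - length ?r)"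
        using False unfolding block_pos_step by (simp add: of_nat_diff)
      then show ?thesis using False wk by (simp add: nth_append)
    qed
  qed
  then have base: "word_at y (block_pos \<theta> x n) (length w) = w" for n
    by (intro nth_equalityI) auto
  show ?thesis
  proof (induction m arbitrary: n)
    case 0
    then show ?case using base by (simp add: word_at_def)
  next
    case (Suc m)
    let ?u = "concat (map \<theta> (word_at x (n + 1) m)) @ w"
    have "word_at y (block_pos \<theta> x n) (length (\<theta> (x n)) + length ?u) = \<theta> (x n) @ ?u"
      unfolding word_at_append_iff using word_at_block_pos[OF im] Suc[of "n + 1"]
      by (simp add: block_pos_step)
    then show ?case by (simp add: word_at_Suc add.assoc)
  qed
qed

text \<open>Starting from the occurrence of \<open>w\<close> at 0, follow the next return word to
  the right and the previous one to the left, indefinitely. Uniqueness of the parse makes the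
  resulting \<open>x\<close> begin with the prescribed \<open>v\<close>.\<close>

lemma (in recurrent_language) exists_desubstitution:
  fixes \<theta> :: "nat \<Rightarrow> 'a list" and y :: "int \<Rightarrow> 'a"
  assumes \<theta>: "bij_betw \<theta> I (returns L w)" and wL: "w \<in> L" and w: "w \<noteq> []"
    and y: "\<And>i n. word_at y i n \<in> L"
    and v: "set v \<subseteq> I" "word_at y 0 (length (concat (map \<theta> v) @ w)) = concat (map \<theta> v) @ w"
  shows "\<exists>x. (\<forall>i. x i \<in> I) \<and> morphism_image \<theta> x y \<and> word_at x 0 (length v) = v"
proof -
  define occ where "occ i \<longleftrightarrow> word_at y i (length w) = w" for i
  define B where "B = Max (length ` (returns L w \<union> right_returns L w))"
  have B: "length r \<le> B" if "r \<in> returns L w \<union> right_returns L w" for r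
    unfolding B_def using that finite_returns[OF wL] finite_right_returns[OF wL] by simp
  have "\<exists>j\<in>I. word_at y i (length (\<theta> j) + length w) = \<theta> j @ w" if i: "occ i" for i
  proof -
    \<comment> \<open>\<open>B\<close> further letters suffice to read the next right return in
      full.\<close>
    define s where "s = word_at y (i + int (length w)) B"
    have ws: "word_at y i (length w + B) = w @ s"
      unfolding word_at_append_iff s_def using i unfolding occ_def by simp
    have "[] @ w @ s \<in> L" using y[of i "length w + B"] unfolding ws by simp
    from right_completion[OF w this] obtain q where q: "q \<in> right_returns L w" "prefix q s \<or> prefix s q"
      by blast
    have "length q \<le> length s" using B q(1) unfolding s_def by simp
    then have "prefix q s" using q(2) by (metis prefix_length_le prefix_length_prefix prefix_order.refl prefix_same_cases)
    then obtain t where t: "s = q @ t" by (auto simp: prefix_def)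
    obtain j where j: "j \<in> I" "q = conjugate w (\<theta> j)"
      using q(1) bij_betw_imp_surj_on[OF bij_betw_trans[OF \<theta> bij_betw_conjugate]] by (metis comp_apply imageE)
    then have wq: "w @ q = \<theta> j @ w" using append_conjugate bij_betw_apply[OF \<theta>] by blast
    from arg_cong[OF this, of length] have len: "length q = length (\<theta> j)" by simp
    have "B = length q + length t" using t unfolding s_def by (metis length_append length_word_at)
    then have "word_at y i (length (w @ q) + length t) = (w @ q) @ t" using ws t by (simp add: add.assoc)
    then have "word_at y i (length (w @ q)) = w @ q" unfolding word_at_append_iff by blast
    then show ?thesis using j(1) wq len by (intro bexI[of _ j]) (auto simp: add.commute)
  qed
  then obtain F where F: "\<And>i. occ i \<Longrightarrow> F i \<in> I"
    "\<And>i. occ i \<Longrightarrow> word_at y i (length (\<theta> (F i)) + length w) = \<theta> (F i) @ w" by metis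
  have "\<exists>j\<in>I. word_at y (i - int (length (\<theta> j))) (length (\<theta> j) + length w) = \<theta> j @ w" if i: "occ i" for i
  proof -
    define p where "p = word_at y (i - int B) B"
    have lp: "length p = B" unfolding p_def by simp
    have "word_at y (i - int B) (length p + length w) = p @ w"
      unfolding word_at_append_iff using i unfolding occ_def p_def by simp
    then have "p @ w @ [] \<in> L" using y[of "i - int B" "length p + length w"] by simp
    from left_completion[OF w this] obtain r where r: "r \<in> returns L w" "suffix r p \<or> suffix p r"
      by blast
    have "length r \<le> length p" using B r(1) unfolding lp by simp
    then have "suffix r p" using r(2) by (metis suffix_length_le suffix_length_suffix suffix_order.refl suffix_same_cases)
    then obtain t where t: "p = t @ r" by (auto simp: suffix_def)
    then have lB: "B = length t + length r" using lp by simp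
    obtain j where j: "j \<in> I" "r = \<theta> j"
      using r(1) bij_betw_imp_surj_on[OF \<theta>] by (metis imageE)
    have "word_at y (i - int B) (length t + length r) = t @ r"
      using t lB unfolding p_def by metis
    then have "word_at y (i - int B + int (length t)) (length r) = r"
      unfolding word_at_append_iff by blast
    moreover have "i - int B + int (length t) = i - int (length r)" using lB by simp
    ultimately have "word_at y (i - int (length r)) (length r) = r" by simp
    then have "word_at y (i - int (length r)) (length r + length w) = r @ w"
      unfolding word_at_append_iff using i unfolding occ_def by simp
    then show ?thesis using j by blast
  qed
  then obtain G where G: "\<And>i. occ i \<Longrightarrow> G i \<in> I"
    "\<And>i. occ i \<Longrightarrow> word_at y (i - int (length (\<theta> (G i)))) (length (\<theta> (G i)) + length w) = \<theta> (G i) @ w" by metis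
  define pf where "pf = rec_nat (0::int) (\<lambda>_ i. i + int (length (\<theta> (F i))))"
  have pf: "pf 0 = 0" "\<And>n. pf (Suc n) = pf n + int (length (\<theta> (F (pf n))))" unfolding pf_def by simp_all
  define pb where "pb = rec_nat (0::int) (\<lambda>_ i. i - int (length (\<theta> (G i))))"
  have pb: "pb 0 = 0" "\<And>n. pb (Suc n) = pb n - int (length (\<theta> (G (pb n))))" unfolding pb_def by simp_all
  \<comment> \<open>\<open>pb n\<close> is the start of block \<open>-n\<close>, so block
    \<open>-(n + 1)\<close> is the return word ending at \<open>pb n\<close>; hence the shift by one
    for negative indices.\<close>
  define x where "x k = (if 0 \<le> k then F (pf (nat k)) else G (pb (nat (- k - 1))))" for k :: int
  have occ_prefix: "occ i" if "word_at y i (length u) = u" "prefix w u" for i u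
    using that word_at_append_iff[of y i w] unfolding occ_def prefix_def by (metis length_append)
  have "prefix w (concat (map \<theta> v) @ w)"
    using v(1) bij_betw_apply[OF \<theta>] by (intro prefix_concat_returns[of _ L]) auto
  then have occ0: "occ 0" by (rule occ_prefix[OF v(2)])
  have occ_pf: "occ (pf n)" for n
  proof (induction n)
    case (Suc n)
    then show ?case using F(2)[OF Suc] unfolding word_at_append_iff occ_def pf by blast
  qed (simp add: occ0 pf)
  have occ_pb: "occ (pb n)" for n
  proof (induction n)
    case (Suc n)
    let ?r = "\<theta> (G (pb n))"
    have "prefix w (?r @ w)" using returnsD(4)[OF bij_betw_apply[OF \<theta> G(1)[OF Suc]]] .
    then show ?case unfolding pb using G(2)[OF Suc] by (intro occ_prefix[of _ "?r @ w"]) simp_all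
  qed (simp add: occ0 pb)
  have xI: "x i \<in> I" for i unfolding x_def using F(1) G(1) occ_pf occ_pb by simp
  have bp_pf: "block_pos \<theta> x (int n) = pf n" for n
  proof (induction n)
    case (Suc n)
    have "block_pos \<theta> x (int (Suc n)) = block_pos \<theta> x (int n + 1)" by (simp add: add.commute)
    also have "\<dots> = pf (Suc n)" unfolding block_pos_step Suc pf x_def by simp
    finally show ?case .
  qed (simp add: block_pos_def pf)
  have x_neg: "x (- int (Suc n)) = G (pb n)" for n unfolding x_def by simp
  have bp_pb: "block_pos \<theta> x (- int n) = pb n" for n
  proof (induction n)
    case (Suc n)
    have "block_pos \<theta> x (- int (Suc n) + 1) = pb n" using Suc by simp
    then show ?case unfolding block_pos_step pb x_neg by simp
  qed (simp add: block_pos_def pb)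
  have "word_at y (block_pos \<theta> x n) (length (\<theta> (x n))) = \<theta> (x n)" for n
  proof (cases "0 \<le> n")
    case True
    then obtain m where m: "n = int m" using nonneg_int_cases by blast
    then have "x n = F (pf m)" unfolding x_def by simp
    then show ?thesis using F(2)[OF occ_pf[of m]] unfolding m bp_pf word_at_append_iff by simp
  next
    case False
    then obtain m where m: "n = - int (Suc m)" by (metis not_le int_cases of_nat_0_le_iff)
    show ?thesis using G(2)[OF occ_pb[of m]] unfolding m bp_pb x_neg word_at_append_iff by (simp add: pb)
  qed
  then have "morphism_image \<theta> x y" unfolding morphism_image_def by (metis nth_word_at)
  \<comment> \<open>Generalised to start at any block \<open>n\<close>, so that the induction on
    \<open>v\<close> can advance by one block.\<close>
  moreover have "word_at x (int n) (length v) = v"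
    if "set v \<subseteq> I" "word_at y (pf n) (length (concat (map \<theta> v) @ w)) = concat (map \<theta> v) @ w" for n v
    using that
  proof (induction v arbitrary: n)
    case (Cons j v)
    let ?u = "concat (map \<theta> v) @ w"
    have j: "\<theta> j \<in> returns L w" using Cons.prems(1) bij_betw_apply[OF \<theta>] by simp
    have *: "word_at y (pf n) (length (\<theta> j) + length ?u) = \<theta> j @ ?u" using Cons.prems(2) by (simp add: add.assoc)
    have "prefix w ?u"
      using Cons.prems(1) bij_betw_apply[OF \<theta>] by (intro prefix_concat_returns[of _ L]) auto
    then obtain t where t: "?u = w @ t" by (auto simp: prefix_def)
    \<comment> \<open>A window long enough to contain both the given parse and the block chosen by
      \<open>F\<close>, so that the two can be compared as prefixes of one word.\<close>
    define b where "b = length (\<theta> j @ ?u) + (length (\<theta> (F (pf n))) + length w)"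
    have "prefix (\<theta> j @ w) (\<theta> j @ ?u)" unfolding t by simp
    then have "prefix (\<theta> j @ w) (word_at y (pf n) (length (\<theta> j) + length ?u))" unfolding * .
    moreover have "prefix (word_at y (pf n) (length (\<theta> j) + length ?u)) (word_at y (pf n) b)"
      unfolding b_def length_append word_at_add by simp
    ultimately have 1: "prefix (\<theta> j @ w) (word_at y (pf n) b)" by (rule prefix_order.trans)
    have "b = (length (\<theta> (F (pf n))) + length w) + length (\<theta> j @ ?u)" unfolding b_def by simp
    then have 2: "prefix (\<theta> (F (pf n)) @ w) (word_at y (pf n) b)"
      using word_at_add[of y "pf n" "length (\<theta> (F (pf n))) + length w" "length (\<theta> j @ ?u)"]
        F(2)[OF occ_pf[of n]] by simp
    have FI: "F (pf n) \<in> I" using F(1) occ_pf by blast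
    have "\<theta> j = \<theta> (F (pf n))"
      by (rule returns_prefix_unique[OF j bij_betw_apply[OF \<theta> FI] 1 2])
    then have jF: "j = F (pf n)"
      using bij_betw_imp_inj_on[OF \<theta>] FI Cons.prems(1) by (simp add: inj_on_eq_iff)
    have "word_at y (pf (Suc n)) (length ?u) = ?u"
      using * unfolding word_at_append_iff pf jF by blast
    then have "word_at x (int (Suc n)) (length v) = v"
      using Cons.prems(1) by (intro Cons.IH) auto
    moreover have "x (int n) = j" unfolding x_def jF by simp
    ultimately show ?case by (simp add: word_at_Suc add.commute)
  qed (simp add: word_at_def)
  from this[of v 0] have "word_at x 0 (length v) = v" using v pf(1) by simp
  ultimately show ?thesis using xI by blast
qed

lemma return_words_eq_returns: "return_words X w = returns (language X) w"
  unfolding return_words_def returns_def ..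

text \<open>The trailing \<open>w\<close> marks the end of the last block: without it,
  \<open>concat (map \<theta> v)\<close> could occur in \<open>X\<close> without being parsed into
  these return words.\<close>

lemma derived_shift_language:
  assumes "finite A" "minimal_shift A X" and w: "w \<in> language X" "w \<noteq> []"
    and \<theta>: "coding_morphism X w \<theta>"
  shows "v \<in> language (derived_shift X w \<theta>) \<longleftrightarrow>
    set v \<subseteq> {1..card (return_words X w)} \<and> concat (map \<theta> v) @ w \<in> language X"
proof -
  interpret recurrent_language "language X" A by (rule recurrent_language_language[OF assms(1,2)])
  let ?I = "{1..card (return_words X w)}"
  have bij: "bij_betw \<theta> ?I (returns (language X) w)"
    using \<theta> unfolding coding_morphism_def return_words_eq_returns .
  have inv: "shift_map ` X = X" using assms(2) unfolding minimal_shift_def shift_space_def by blast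
  show ?thesis
  proof
    assume "v \<in> language (derived_shift X w \<theta>)"
    then obtain x i where x: "x \<in> derived_shift X w \<theta>" "word_at x i (length v) = v" by (rule mem_languageE)
    then obtain y where y: "\<And>i. x i \<in> ?I" "y \<in> X" "morphism_image \<theta> x y"
      unfolding derived_shift_def by auto
    have "\<theta> (x n) \<in> returns (language X) w" for n using y(1) bij_betw_apply[OF bij] by blast
    from word_at_morphism_image[OF y(3) this, of i "length v"] x(2)
    have "word_at y (block_pos \<theta> x i) (length (concat (map \<theta> v) @ w)) = concat (map \<theta> v) @ w" by simp
    then have "concat (map \<theta> v) @ w \<in> language X" using mem_languageI[OF y(2)] by metis
    moreover have "set (word_at x i (length v)) \<subseteq> ?I" unfolding word_at_def using y(1) by auto
    ultimately show "set v \<subseteq> ?I \<and> concat (map \<theta> v) @ w \<in> language X" using x(2) by simp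
  next
    assume v: "set v \<subseteq> ?I \<and> concat (map \<theta> v) @ w \<in> language X"
    then obtain z i where z: "z \<in> X"
      "word_at z i (length (concat (map \<theta> v) @ w)) = concat (map \<theta> v) @ w" by (blast elim: mem_languageE)
    \<comment> \<open>Recentred because \<open>morphism_image\<close> places block 0 at the
      origin.\<close>
    define y where "y k = z (k + i)" for k
    have yX: "y \<in> X" unfolding y_def by (rule shift_invariant[OF inv z(1)])
    have "word_at y 0 n = word_at z i n" for n by (rule nth_equalityI) (auto simp: y_def algebra_simps)
    then have "word_at y 0 (length (concat (map \<theta> v) @ w)) = concat (map \<theta> v) @ w" using z(2) by simp
    from exists_desubstitution[OF bij w mem_languageI[OF yX] _ this] v obtain x where
      "\<forall>i. x i \<in> ?I" "morphism_image \<theta> x y" "word_at x 0 (length v) = v" by blast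
    then show "v \<in> language (derived_shift X w \<theta>)"
      using yX mem_languageI[of x "derived_shift X w \<theta>" 0 "length v"] unfolding derived_shift_def by auto
  qed
qed

lemma dendric_derived_shift_iff:
  "dendric_shift (derived_shift X w \<theta>) \<longleftrightarrow>
    (\<forall>v\<in>language (derived_shift X w \<theta>). tree_rel (ext_rel (language (derived_shift X w \<theta>)) v))"
proof -
  have "derived_shift X w \<theta> \<subseteq> configs {1..card (return_words X w)}"
    unfolding derived_shift_def configs_def by auto
  from dendric_word_iff[OF _ this] show ?thesis unfolding dendric_shift_def by blast
qed

text \<open>Codings exist by \<open>finite_returns\<close>, so quantifying over all
  \<open>\<theta>\<close> is not vacuous.\<close>

theorem mainTheorem14:
  fixes A :: "'a set" and X :: "(int \<Rightarrow> 'a) set"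
  assumes "finite A" and "minimal_shift A X"
  shows "(eventually_dendric X \<longleftrightarrow>
            (\<exists>w \<in> language X. w \<noteq> [] \<and>
               (\<forall>\<theta>. coding_morphism X w \<theta> \<longrightarrow> dendric_shift (derived_shift X w \<theta>))))
       \<and> (eventually_dendric X \<longleftrightarrow>
            (\<exists>N. \<forall>w \<in> language X. w \<noteq> [] \<and> length w \<ge> N \<longrightarrow>
               (\<forall>\<theta>. coding_morphism X w \<theta> \<longrightarrow> dendric_shift (derived_shift X w \<theta>))))"
    (is "(?ev \<longleftrightarrow> ?one) \<and> (?ev \<longleftrightarrow> ?all)")
proof -
  interpret recurrent_language "language X" A by (rule recurrent_language_language[OF assms])
  have X: "X \<subseteq> configs A" "X \<noteq> {}" using assms(2) unfolding minimal_shift_def shift_space_def by auto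
  have ev: "?ev \<longleftrightarrow> (\<exists>N. \<forall>w\<in>language X. N \<le> length w \<longrightarrow> tree_rel (ext_rel (language X) w))"
    unfolding eventually_dendric_def dendric_word_iff[OF assms(1) X(1)] ..
  have bij: "bij_betw \<theta> {1..card (return_words X w)} (returns (language X) w)"
    if "coding_morphism X w \<theta>" for w \<theta>
    using that unfolding coding_morphism_def return_words_eq_returns .
  have "?ev \<Longrightarrow> ?all"
  proof -
    assume ?ev
    then obtain N where N: "\<And>w. w \<in> language X \<Longrightarrow> N \<le> length w \<Longrightarrow> tree_rel (ext_rel (language X) w)"
      unfolding ev by blast
    have "dendric_shift (derived_shift X w \<theta>)"
      if "w \<in> language X" "w \<noteq> []" "N \<le> length w" "coding_morphism X w \<theta>" for w \<theta>
      unfolding dendric_derived_shift_iff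
      using tree_rel_derived[OF N that(2,3) bij[OF that(4)] derived_shift_language[OF assms that(1,2,4)]]
      by blast
    then show ?all by blast
  qed
  moreover have "?all \<Longrightarrow> ?one"
  proof -
    assume ?all
    then obtain N where N: "\<And>w \<theta>. w \<in> language X \<Longrightarrow> w \<noteq> [] \<Longrightarrow> N \<le> length w \<Longrightarrow>
        coding_morphism X w \<theta> \<Longrightarrow> dendric_shift (derived_shift X w \<theta>)" by blast
    obtain x where "x \<in> X" using X(2) by blast
    \<comment> \<open>Length \<open>Suc N\<close> keeps the word nonempty even when
      \<open>N = 0\<close>.\<close>
    from mem_languageI[OF this, of 0 "Suc N"] have w: "word_at x 0 (Suc N) \<in> language X" .
    have "word_at x 0 (Suc N) \<noteq> []" "N \<le> length (word_at x 0 (Suc N))"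
      by (auto simp flip: length_0_conv)
    then show ?one using N[OF w] w by blast
  qed
  moreover have "?one \<Longrightarrow> ?ev"
  proof -
    assume ?one
    then obtain w where w: "w \<in> language X" "w \<noteq> []"
      "\<And>\<theta>. coding_morphism X w \<theta> \<Longrightarrow> dendric_shift (derived_shift X w \<theta>)" by blast
    obtain \<theta> where \<theta>: "coding_morphism X w \<theta>"
      unfolding coding_morphism_def return_words_eq_returns
      using ex_bij_betw_nat_finite_1[OF finite_returns[OF w(1)]] by blast
    let ?D = "derived_shift X w \<theta>"
    have D: "?D \<subseteq> configs {1..card (return_words X w)}"
      unfolding derived_shift_def configs_def by auto
    interpret D: ext_language "language ?D" "{1..card (return_words X w)}"
      by (rule ext_language_language[OF _ D]) simp
    have "tree_rel (ext_rel (language ?D) v)" if "v \<in> language ?D" for v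
      using w(3)[OF \<theta>] that unfolding dendric_derived_shift_iff by blast
    then obtain M where M: "\<And>v. v \<in> language ?D \<Longrightarrow> M \<le> length v \<Longrightarrow>
        \<exists>P Q a b. a \<in> P \<and> b \<in> Q \<and> ext_rel (language ?D) v = P \<times> {b} \<union> {a} \<times> Q"
      using D.eventually_double_star[of 0] by blast
    show ?ev
      unfolding ev
      by (rule eventually_tree_rel_of_derived[OF w(1,2) bij[OF \<theta>] derived_shift_language[OF assms w(1,2) \<theta>] M])
  qed
  ultimately show ?thesis by blast
qed

end
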